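(* Let $(M,\Omega)$ be a locally homogeneous multisymplectic manifold of degree $k$. Then the only differential forms of degree $k$ on $M$ invariant under the graded Lie algebra of infinitesimal automorphisms of $\Omega$ are the real multiples of $\Omega$. That is, if $\alpha$ is a differential $k$-form on $M$ with $L(X)\alpha=0$ for every locally Hamiltonian $m$-vector field $X$ on $M$ and every $0\le m\le k$, then $\alpha=c\,\Omega$ for some $c\in\mathbb{R}$.
   Context: All manifolds are real, paracompact, connected and $C^\infty$; $\dim M=n$. A multisymplectic manifold of degree $k\ge 2$ is a pair $(M,\Omega)$ where $\Omega$ is a closed $k$-form on $M$ that is $1$-nondegenerate, i.e. for every $x\in M$ the map $T_xM\to\Lambda^{k-1}(T_x^*M)$, $v\mapsto i(v)\Omega_x$, is injective. An $m$-vector field is a smooth section of $\Lambda^m(TM)$; contraction is determined by $i(v_1\wedge\dots\wedge v_m)=i(v_1)\cdots i(v_m)$, and the Lie derivative along an $m$-vector field $X$ is $L(X)=d\,i(X)-(-1)^m i(X)\,d$. An $m$-vector field $X$ is locally Hamiltonian if $i(X)\Omega$ is closed (for $m=0$, $X$ is a function and $i(X)\Omega=X\Omega$). The graded Lie algebra of infinitesimal automorphisms of $(M,\Omega)$ is $\bigoplus_{m=0}^k \mathfrak{X}^m_{lh}(M)/\ker^m\Omega$, where $\mathfrak{X}^m_{lh}(M)$ is the set of locally Hamiltonian $m$-vector fields and $\ker^m\Omega$ is the set of $m$-vector fields $X$ with $i(X)\Omega=0$. Local Euler-like vector field: let $x\in M$ and let $K$ be a compact set with $x$ in the interior of $K$.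 A local Euler-like vector field at $x$ with respect to $K$ is a vector field $\Delta^x$ on $M$ such that $\operatorname{supp}\Delta^x=\overline{\{y\in M: \Delta^x(y)\neq 0\}}\subset K$, and such that there is a diffeomorphism $\varphi$ from the interior of $\operatorname{supp}\Delta^x$ onto $\mathbb{R}^n$ with $\varphi(x)=0$ and $\varphi_*\Delta^x=x^i\,\partial/\partial x^i$ (the standard dilation vector field on $\mathbb{R}^n$). Locally homogeneous: a differential form $\Omega$ on $M$ is locally homogeneous at $x\in M$ if for every open set $U$ containing $x$ there exist a compact set $K\subset U$ and a local Euler-like vector field $\Delta^x$ at $x$ with respect to $K$ such that $L(\Delta^x)\Omega=f\,\Omega$ on $U$ for some $f\in C^\infty(U)$. $\Omega$ is locally homogeneous if this holds at every $x\in M$. A locally homogeneous multisymplectic manifold is a multisymplectic manifold $(M,\Omega)$ with $\Omega$ locally homogeneous. *)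

theory Defs
  imports "HOL-Analysis.Analysis"
begin

section \<open>Smooth maps between open subsets of Euclidean spaces\<close>

text \<open>Only used for open sets \<open>S\<close>.\<close>

primrec Ck_on :: "nat \<Rightarrow> 'e::euclidean_space set \<Rightarrow> ('e \<Rightarrow> 'f::real_normed_vector) \<Rightarrow> bool" where
  "Ck_on 0 S f \<longleftrightarrow> continuous_on S f"
| "Ck_on (Suc r) S f \<longleftrightarrow>
     (\<forall>x\<in>S. f differentiable (at x)) \<and> (\<forall>v. Ck_on r S (\<lambda>x. frechet_derivative f (at x) v))"

definition smooth_on :: "'e::euclidean_space set \<Rightarrow> ('e \<Rightarrow> 'f::real_normed_vector) \<Rightarrow> bool" where
  "smooth_on S f \<longleftrightarrow> (\<forall>r. Ck_on r S f)"


section \<open>Manifolds\<close>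

text \<open>
  A chart is a pair of a domain and a coordinate map; the coordinate map is irrelevant outside the
  domain. A manifold is a topological space (the whole type \<open>'a\<close>) with an atlas \<open>A\<close>, not
  necessarily maximal, with values in a Euclidean space \<open>'e\<close> of dimension \<open>n = DIM('e)\<close>.
\<close>

type_synonym ('a, 'e) chart = "'a set \<times> ('a \<Rightarrow> 'e)"

definition chart_inv :: "('a, 'e) chart \<Rightarrow> 'e \<Rightarrow> 'a" where
  "chart_inv c = inv_into (fst c) (snd c)"

definition is_chart :: "('a::topological_space, 'e::euclidean_space) chart \<Rightarrow> bool" where
  "is_chart c \<longleftrightarrow> open (fst c) \<and> open (snd c ` fst c) \<and>
     homeomorphism (fst c) (snd c ` fst c) (snd c) (chart_inv c)"

definition compatible :: "('a, 'e::euclidean_space) chart \<Rightarrow> ('a, 'e) chart \<Rightarrow> bool" where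
  "compatible c d \<longleftrightarrow>
     smooth_on (snd c ` (fst c \<inter> fst d)) (snd d \<circ> chart_inv c) \<and>
     smooth_on (snd d ` (fst c \<inter> fst d)) (snd c \<circ> chart_inv d)"

definition smooth_atlas :: "('a::topological_space, 'e::euclidean_space) chart set \<Rightarrow> bool" where
  "smooth_atlas A \<longleftrightarrow>
     (\<forall>c\<in>A. is_chart c) \<and> (\<Union>c\<in>A. fst c) = UNIV \<and> (\<forall>c\<in>A. \<forall>d\<in>A. compatible c d)"

definition paracompact :: "'a::topological_space itself \<Rightarrow> bool" where
  "paracompact _ \<longleftrightarrow>
     (\<forall>\<U>::'a set set. (\<forall>U\<in>\<U>. open U) \<and> \<Union>\<U> = UNIV \<longrightarrow>
        (\<exists>\<V>. (\<forall>V\<in>\<V>. open V) \<and> \<Union>\<V> = UNIV \<and> (\<forall>V\<in>\<V>. \<exists>U\<in>\<U>. V \<subseteq> U) \<and>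
             locally_finite_in euclidean \<V>))"

definition smooth_manifold :: "('a::t2_space, 'e::euclidean_space) chart set \<Rightarrow> bool" where
  "smooth_manifold A \<longleftrightarrow> smooth_atlas A \<and> paracompact TYPE('a) \<and> connected (UNIV :: 'a set)"

definition smooth_fun_on ::
    "('a, 'e::euclidean_space) chart set \<Rightarrow> 'a set \<Rightarrow> ('a \<Rightarrow> real) \<Rightarrow> bool" where
  "smooth_fun_on A U f \<longleftrightarrow> (\<forall>c\<in>A. smooth_on (snd c ` (fst c \<inter> U)) (f \<circ> chart_inv c))"

text \<open>
  A diffeomorphism from an open subset \<open>W\<close> of the manifold onto an open subset of \<open>'e\<close> is the same
  thing as a coordinate map \<open>\<phi>\<close> on \<open>W\<close> such that both \<open>\<phi>\<close> and its inverse are smooth when read in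
  the charts of the atlas.
\<close>

definition diffeomorphism_onto ::
    "('a::topological_space, 'e::euclidean_space) chart set \<Rightarrow> 'a set \<Rightarrow> 'e set \<Rightarrow> ('a \<Rightarrow> 'e) \<Rightarrow> bool" where
  "diffeomorphism_onto A W V \<phi> \<longleftrightarrow>
     is_chart (W, \<phi>) \<and> \<phi> ` W = V \<and> (\<forall>c\<in>A. compatible c (W, \<phi>))"


section \<open>Tangent vectors\<close>

text \<open>
  The tangent space at \<open>x\<close> is \<open>'e\<close>: a tangent vector at \<open>x\<close> is given by its coordinates in one
  chosen chart \<open>chart_at A x\<close> around \<open>x\<close>. The two maps below convert between tangent vectors and
  coordinate vectors in an arbitrary chart \<open>c\<close> around \<open>x\<close>; they are the derivatives of the
  coordinate changes. All smoothness conditions are imposed in the charts of the atlas, since the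
  chosen chart may vary discontinuously with \<open>x\<close>.
\<close>

definition chart_at :: "('a, 'e) chart set \<Rightarrow> 'a \<Rightarrow> ('a, 'e) chart" where
  "chart_at A x = (SOME c. c \<in> A \<and> x \<in> fst c)"

definition to_chart ::
    "('a, 'e::euclidean_space) chart set \<Rightarrow> ('a, 'e) chart \<Rightarrow> 'a \<Rightarrow> 'e \<Rightarrow> 'e" where
  "to_chart A c x =
     frechet_derivative (snd c \<circ> chart_inv (chart_at A x)) (at (snd (chart_at A x) x))"

definition from_chart ::
    "('a, 'e::euclidean_space) chart set \<Rightarrow> ('a, 'e) chart \<Rightarrow> 'a \<Rightarrow> 'e \<Rightarrow> 'e" where
  "from_chart A c x =
     frechet_derivative (snd (chart_at A x) \<circ> chart_inv c) (at (snd c x))"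

definition vector_field :: "('a, 'e::euclidean_space) chart set \<Rightarrow> ('a \<Rightarrow> 'e) \<Rightarrow> bool" where
  "vector_field A X \<longleftrightarrow>
     (\<forall>c\<in>A. smooth_on (snd c ` fst c) (\<lambda>y. to_chart A c (chart_inv c y) (X (chart_inv c y))))"


section \<open>Differential forms\<close>

text \<open>
  Alternating \<open>k\<close>-linear forms are functions on lists of vectors that vanish on lists whose length
  is not \<open>k\<close>, so that equality of functions is equality of forms.
\<close>

type_synonym 'e covector = "'e list \<Rightarrow> real"

definition alternating :: "nat \<Rightarrow> 'e::real_vector covector \<Rightarrow> bool" where
  "alternating k f \<longleftrightarrow>
     (\<forall>vs. length vs \<noteq> k \<longrightarrow> f vs = 0) \<and>
     (\<forall>vs i. length vs = k \<and> i < k \<longrightarrow> linear (\<lambda>v. f (vs[i := v]))) \<and>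
     (\<forall>vs i j. length vs = k \<and> i < j \<and> j < k \<and> vs ! i = vs ! j \<longrightarrow> f vs = 0)"

definition form_in_chart ::
    "('a, 'e::euclidean_space) chart set \<Rightarrow> ('a, 'e) chart \<Rightarrow> ('a \<Rightarrow> 'e covector) \<Rightarrow> 'e \<Rightarrow> 'e covector" where
  "form_in_chart A c \<omega> y vs =
     \<omega> (chart_inv c y) (map (from_chart A c (chart_inv c y)) vs)"

definition differential_form ::
    "('a, 'e::euclidean_space) chart set \<Rightarrow> nat \<Rightarrow> ('a \<Rightarrow> 'e covector) \<Rightarrow> bool" where
  "differential_form A k \<omega> \<longleftrightarrow>
     (\<forall>x. alternating k (\<omega> x)) \<and>
     (\<forall>c\<in>A. \<forall>vs. length vs = k \<longrightarrow> smooth_on (snd c ` fst c) (\<lambda>y. form_in_chart A c \<omega> y vs))"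

text \<open>
  The coordinate formula
  \<open>d\<omega>(v\<^sub>0,\<dots>,v\<^sub>k) = \<Sum>\<^sub>i (-1)^i D(\<omega>(v\<^sub>0,\<dots>,v\<^sub>i omitted,\<dots>,v\<^sub>k))(v\<^sub>i)\<close>, evaluated at \<open>x\<close> in
  the chart in which tangent vectors at \<open>x\<close> are expressed.
\<close>

definition ext_deriv ::
    "('a, 'e::euclidean_space) chart set \<Rightarrow> ('a \<Rightarrow> 'e covector) \<Rightarrow> 'a \<Rightarrow> 'e covector" where
  "ext_deriv A \<omega> x vs =
     (\<Sum>i<length vs. (-1) ^ i *
        frechet_derivative
          (\<lambda>y. form_in_chart A (chart_at A x) \<omega> y (take i vs @ drop (Suc i) vs))
          (at (snd (chart_at A x) x)) (vs ! i))"

definition closed_form ::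
    "('a, 'e::euclidean_space) chart set \<Rightarrow> ('a \<Rightarrow> 'e covector) \<Rightarrow> bool" where
  "closed_form A \<omega> \<longleftrightarrow> (\<forall>x vs. ext_deriv A \<omega> x vs = 0)"


section \<open>Multivector fields\<close>

text \<open>
  The exterior power \<open>\<Lambda>\<^sup>m('e)\<close> is realised inside the dual of the space of alternating \<open>m\<close>-linear
  forms: the product \<open>v\<^sub>1 \<and> \<dots> \<and> v\<^sub>m\<close> is evaluation at \<open>(v\<^sub>1,\<dots>,v\<^sub>m)\<close>, and \<open>\<Lambda>\<^sup>m('e)\<close> is the span
  of these products. Since \<open>'e\<close> is finite-dimensional, the alternating forms separate multivectors,
  so this is the usual exterior power. The value on functions that are not alternating \<open>m\<close>-linear
  is fixed to be \<open>0\<close>. For \<open>m = 0\<close> the empty product \<open>wedge []\<close> is the scalar \<open>1\<close>.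
\<close>

type_synonym 'e multivector = "'e covector \<Rightarrow> real"

definition wedge :: "'e::real_vector list \<Rightarrow> 'e multivector" where
  "wedge vs = (\<lambda>f. if alternating (length vs) f then f vs else 0)"

definition multivectors :: "nat \<Rightarrow> 'e::real_vector multivector set" where
  "multivectors m =
     {\<xi>. \<exists>(N::nat) (a :: nat \<Rightarrow> real) (w :: nat \<Rightarrow> 'e list).
          (\<forall>i<N. length (w i) = m) \<and> \<xi> = (\<lambda>f. \<Sum>i<N. a i * wedge (w i) f)}"

text \<open>
  Smoothness of an \<open>m\<close>-vector field: in every chart of the atlas, its pairings with all constant
  alternating \<open>m\<close>-linear forms (equivalently, its components) are smooth.
\<close>

definition multivector_field ::
    "('a, 'e::euclidean_space) chart set \<Rightarrow> nat \<Rightarrow> ('a \<Rightarrow> 'e multivector) \<Rightarrow> bool" where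
  "multivector_field A m X \<longleftrightarrow>
     (\<forall>x. X x \<in> multivectors m) \<and>
     (\<forall>c\<in>A. \<forall>f. alternating m f \<longrightarrow>
        smooth_on (snd c ` fst c)
          (\<lambda>y. X (chart_inv c y) (\<lambda>vs. f (map (to_chart A c (chart_inv c y)) vs))))"

definition interior_product :: "'e \<Rightarrow> 'e covector \<Rightarrow> 'e covector" where
  "interior_product v f = (\<lambda>ws. f (v # ws))"

text \<open>
  The list is reversed because \<open>i(v\<^sub>1 \<and> \<dots> \<and> v\<^sub>m) = i(v\<^sub>1) \<cdots> i(v\<^sub>m)\<close> inserts \<open>v\<^sub>m\<close> first;
  see the lemma \<open>contract_wedge\<close>.
\<close>

definition contract :: "'e::real_vector multivector \<Rightarrow> 'e covector \<Rightarrow> 'e covector" where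
  "contract \<xi> f = (\<lambda>ws. \<xi> (\<lambda>vs. f (rev vs @ ws)))"

lemma foldr_interior_product: "foldr interior_product vs f ws = f (rev vs @ ws)"
  by (induction vs arbitrary: ws) (auto simp: interior_product_def)

lemma alternating_partial:
  assumes f: "alternating k f" and ws: "length ws + m = k"
  shows "alternating m (\<lambda>vs. f (rev vs @ ws))"
  unfolding alternating_def
proof (intro conjI allI impI)
  fix vs :: "'a list"
  assume "length vs \<noteq> m"
  then have "length (rev vs @ ws) \<noteq> k" using ws by simp
  then show "f (rev vs @ ws) = 0" using f unfolding alternating_def by blast
next
  fix vs :: "'a list" and i
  assume "length vs = m \<and> i < m"
  then have i: "length vs = m" "i < m" by auto
  have "linear (\<lambda>v. f ((rev vs @ ws)[m - 1 - i := v]))"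
    using f i ws unfolding alternating_def by auto
  moreover have "rev (vs[i := v]) @ ws = (rev vs @ ws)[m - 1 - i := v]" for v
    using i by (simp add: list_update_append rev_update)
  ultimately show "linear (\<lambda>v. f (rev (vs[i := v]) @ ws))" by simp
next
  fix vs :: "'a list" and i j
  assume "length vs = m \<and> i < j \<and> j < m \<and> vs ! i = vs ! j"
  then have ij: "length vs = m" "i < j" "j < m" "vs ! i = vs ! j" by auto
  have "(rev vs @ ws) ! (m - 1 - j) = (rev vs @ ws) ! (m - 1 - i)"
    using ij by (simp add: nth_append rev_nth)
  moreover have "m - 1 - j < m - 1 - i" "m - 1 - i < k" "length (rev vs @ ws) = k"
    using ij ws by auto
  ultimately show "f (rev vs @ ws) = 0"
    using f unfolding alternating_def by blast
qed

lemma contract_wedge: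
  assumes f: "alternating k f" and vs: "length vs \<le> k"
  shows "contract (wedge vs) f = foldr interior_product vs f"
proof
  fix ws :: "'a list"
  show "contract (wedge vs) f ws = foldr interior_product vs f ws"
  proof (cases "length ws + length vs = k")
    case True
    then show ?thesis
      using alternating_partial[OF f True]
      by (simp add: contract_def wedge_def foldr_interior_product)
  next
    case False
    then have "f (rev vs @ ws) = 0"
      using f unfolding alternating_def by (simp add: add.commute)
    then show ?thesis
      by (simp add: contract_def wedge_def foldr_interior_product)
  qed
qed

definition contract_field ::
    "('a \<Rightarrow> 'e::real_vector multivector) \<Rightarrow> ('a \<Rightarrow> 'e covector) \<Rightarrow> 'a \<Rightarrow> 'e covector" where
  "contract_field X \<omega> = (\<lambda>x. contract (X x) (\<omega> x))"

definition lie_deriv ::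
    "('a, 'e::euclidean_space) chart set \<Rightarrow> nat \<Rightarrow> ('a \<Rightarrow> 'e multivector) \<Rightarrow>
     ('a \<Rightarrow> 'e covector) \<Rightarrow> 'a \<Rightarrow> 'e covector" where
  "lie_deriv A m X \<omega> = (\<lambda>x vs.
     ext_deriv A (contract_field X \<omega>) x vs - (-1) ^ m * contract_field X (ext_deriv A \<omega>) x vs)"


section \<open>Multisymplectic manifolds\<close>

definition multisymplectic ::
    "('a::t2_space, 'e::euclidean_space) chart set \<Rightarrow> nat \<Rightarrow> ('a \<Rightarrow> 'e covector) \<Rightarrow> bool" where
  "multisymplectic A k \<Omega> \<longleftrightarrow>
     smooth_manifold A \<and> 2 \<le> k \<and> differential_form A k \<Omega> \<and> closed_form A \<Omega> \<and>
     (\<forall>x. inj (\<lambda>v. interior_product v (\<Omega> x)))"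

definition locally_hamiltonian ::
    "('a, 'e::euclidean_space) chart set \<Rightarrow> ('a \<Rightarrow> 'e covector) \<Rightarrow> nat \<Rightarrow>
     ('a \<Rightarrow> 'e multivector) \<Rightarrow> bool" where
  "locally_hamiltonian A \<Omega> m X \<longleftrightarrow>
     multivector_field A m X \<and> closed_form A (contract_field X \<Omega>)"

definition local_euler_like ::
    "('a::t2_space, 'e::euclidean_space) chart set \<Rightarrow> 'a \<Rightarrow> 'a set \<Rightarrow> ('a \<Rightarrow> 'e) \<Rightarrow> bool" where
  "local_euler_like A x K \<Delta> \<longleftrightarrow>
     compact K \<and> x \<in> interior K \<and> vector_field A \<Delta> \<and>
     closure {y. \<Delta> y \<noteq> 0} \<subseteq> K \<and>
     (\<exists>\<phi>. let W = interior (closure {y. \<Delta> y \<noteq> 0}) in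
        diffeomorphism_onto A W UNIV \<phi> \<and> x \<in> W \<and> \<phi> x = 0 \<and>
        (\<forall>y\<in>W. to_chart A (W, \<phi>) y (\<Delta> y) = \<phi> y))"

definition locally_homogeneous_at ::
    "('a::t2_space, 'e::euclidean_space) chart set \<Rightarrow> ('a \<Rightarrow> 'e covector) \<Rightarrow> 'a \<Rightarrow> bool" where
  "locally_homogeneous_at A \<Omega> x \<longleftrightarrow>
     (\<forall>U. open U \<and> x \<in> U \<longrightarrow>
        (\<exists>K \<Delta> f. K \<subseteq> U \<and> local_euler_like A x K \<Delta> \<and> smooth_fun_on A U f \<and>
           (\<forall>y\<in>U. \<forall>vs. lie_deriv A 1 (\<lambda>z. wedge [\<Delta> z]) \<Omega> y vs = f y * \<Omega> y vs)))"

definition locally_homogeneous_multisymplectic ::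
    "('a::t2_space, 'e::euclidean_space) chart set \<Rightarrow> nat \<Rightarrow> ('a \<Rightarrow> 'e covector) \<Rightarrow> bool" where
  "locally_homogeneous_multisymplectic A k \<Omega> \<longleftrightarrow>
     multisymplectic A k \<Omega> \<and> (\<forall>x. locally_homogeneous_at A \<Omega> x)"

text \<open>
  Invariance under the graded Lie algebra of infinitesimal automorphisms of \<open>\<Omega>\<close>, expressed, as
  usual, on all representatives of its classes modulo multivector fields annihilating \<open>\<Omega>\<close>.
\<close>

definition invariant_under_automorphisms ::
    "('a, 'e::euclidean_space) chart set \<Rightarrow> nat \<Rightarrow> ('a \<Rightarrow> 'e covector) \<Rightarrow>
     ('a \<Rightarrow> 'e covector) \<Rightarrow> bool" where
  "invariant_under_automorphisms A k \<Omega> \<alpha> \<longleftrightarrow>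
     (\<forall>m\<le>k. \<forall>X. locally_hamiltonian A \<Omega> m X \<longrightarrow> (\<forall>x vs. lie_deriv A m X \<alpha> x vs = 0))"

end

theory Submission
  imports Defs
begin

text \<open>
  Fix a point \<open>x\<close> and the chart in which tangent vectors at \<open>x\<close> are expressed. All test fields below
  are supported in this chart; they are combinations of products of coordinate-constant vector
  fields, with smooth coefficients of compact support.

  Three families of locally Hamiltonian multivector fields determine \<open>\<alpha>\<close>. For two \<open>k\<close>-vectors
  \<open>u\<close> and \<open>v\<close> and a function \<open>h\<close>, the field \<open>X = h (\<Omega>(v) u - \<Omega>(u) v)\<close> satisfies \<open>i(X)\<Omega> = 0\<close>
  identically, so that \<open>d (i(X)\<alpha>) = (-1)^k i(X) d\<alpha>\<close>.

  \<^item> If \<open>h\<close> vanishes at \<open>x\<close> but \<open>dh\<close> does not, the right-hand side is \<open>0\<close> at \<open>x\<close> and the left-hand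
    side is \<open>(\<Omega>(v) \<alpha>(u) - \<Omega>(u) \<alpha>(v)) dh\<close>. Hence \<open>\<alpha> = q \<Omega>\<close> for a function \<open>q\<close>
    (\<open>proportional_pointwise\<close>).

  \<^item> If \<open>h(x) \<noteq> 0\<close>, then \<open>i(X)\<alpha> = 0\<close> by the first step, and therefore
    \<open>\<Omega>(v) d\<alpha>(u,t) = \<Omega>(u) d\<alpha>(v,t)\<close> for every vector \<open>t\<close>. When \<open>u\<close> contains \<open>t\<close> the left-hand side
    is \<open>0\<close>; so \<open>d\<alpha>(v,t) \<noteq> 0\<close> would force \<open>i(t)\<Omega> = 0\<close>, which nondegeneracy excludes. Hence \<open>\<alpha>\<close> is
    closed (\<open>ext_deriv_eq_zero\<close>).

  \<^item> Dually to the injectivity of \<open>v \<mapsto> i(v)\<Omega>\<close>, every covector at \<open>x\<close> is the contraction of \<open>\<Omega>\<close>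
    with a \<open>(k - 1)\<close>-vector, and this can be done smoothly near \<open>x\<close>. So for every function \<open>g\<close>
    supported near \<open>x\<close> there is a field \<open>X\<close> with \<open>i(X)\<Omega> = dg\<close> (\<open>exists_exact_contraction\<close>). As
    \<open>d\<alpha> = 0\<close>, invariance says \<open>0 = d (i(X)\<alpha>) = d (q dg) = dq \<and> dg\<close>. The covector \<open>dg\<close> at \<open>x\<close> is
    arbitrary and the dimension is at least \<open>2\<close>, so \<open>dq = 0\<close> (\<open>factor_derivative\<close>) and \<open>q\<close> is
    constant by connectedness.
\<close>

section \<open>Calculus of smooth maps\<close>

abbreviation dir_deriv :: "('e::real_normed_vector \<Rightarrow> 'f::real_normed_vector) \<Rightarrow> 'e \<Rightarrow> 'e \<Rightarrow> 'f" where
  "dir_deriv f x \<equiv> frechet_derivative f (at x)"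

lemma Ck_on_cong:
  assumes "open S" "Ck_on r S f" "\<And>x. x \<in> S \<Longrightarrow> f x = g x"
  shows "Ck_on r S g"
  using assms(2,3)
proof (induction r arbitrary: f g)
  case 0
  then show ?case by (simp cong: continuous_on_cong)
next
  case (Suc r)
  have "g differentiable (at x)" if "x \<in> S" for x
    using Suc.prems that assms(1) has_derivative_transform_within_open[of f _ x UNIV S g]
    unfolding Ck_on.simps differentiable_def by blast
  moreover have "Ck_on r S (\<lambda>x. dir_deriv g x v)" for v
  proof (rule Suc.IH)
    show "Ck_on r S (\<lambda>x. dir_deriv f x v)" using Suc.prems by simp
    show "dir_deriv f x v = dir_deriv g x v" if "x \<in> S" for x
      using frechet_derivative_transform_within_open[of f x S g] that assms(1) Suc.prems by simp
  qed
  ultimately show ?case by simp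
qed

lemma Ck_on_subset: "Ck_on r S f \<Longrightarrow> T \<subseteq> S \<Longrightarrow> Ck_on r T f"
  by (induction r arbitrary: f) (auto intro: continuous_on_subset)

lemma Ck_on_Suc_D: "Ck_on (Suc r) S f \<Longrightarrow> Ck_on r S f"
proof (induction r arbitrary: f)
  case 0
  then show ?case
    by (auto intro!: differentiable_imp_continuous_on simp: differentiable_on_def
        differentiable_at_withinI)
next
  case (Suc r)
  then show ?case by (metis Ck_on.simps(2))
qed

lemma Ck_on_local:
  assumes "\<And>x. x \<in> S \<Longrightarrow> \<exists>T. open T \<and> x \<in> T \<and> Ck_on r T f"
  shows "Ck_on r S f"
  using assms
proof (induction r arbitrary: f)
  case 0
  then show ?case
    by (metis Ck_on.simps(1) continuous_at_imp_continuous_on continuous_on_eq_continuous_at)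
next
  case (Suc r)
  show ?case
    unfolding Ck_on.simps
  proof (intro conjI ballI allI)
    show "f differentiable (at x)" if "x \<in> S" for x using Suc.prems[OF that] by auto
    show "Ck_on r S (\<lambda>x. dir_deriv f x v)" for v
      by (rule Suc.IH) (use Suc.prems in fastforce)
  qed
qed

lemma Ck_on_const: "Ck_on r S (\<lambda>x. c)"
  by (induction r arbitrary: c) auto

text \<open>
  Any family of derivatives may be used in place of the Frechet derivative; linear images,
  sums, products, inverses and compositions are treated by induction on \<open>r\<close> with this rule.
\<close>

lemma Ck_on_Suc_I:
  assumes "open S" "\<And>x. x \<in> S \<Longrightarrow> (f has_derivative f' x) (at x)"
    and "\<And>v. Ck_on r S (\<lambda>x. f' x v)"
  shows "Ck_on (Suc r) S f"
proof -
  have "dir_deriv f x = f' x" if "x \<in> S" for x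
    using frechet_derivative_at[OF assms(2)[OF that]] by simp
  then have "Ck_on r S (\<lambda>x. dir_deriv f x v)" for v
    by (intro Ck_on_cong[OF assms(1) assms(3)]) simp
  then show ?thesis using assms(2) by (auto simp: differentiable_def)
qed

lemma Ck_on_Suc_has_derivative:
  "Ck_on (Suc r) S f \<Longrightarrow> x \<in> S \<Longrightarrow> (f has_derivative dir_deriv f x) (at x)"
  by (simp add: frechet_derivative_works)

lemma Ck_on_linear:
  assumes "open S" "bounded_linear L" "Ck_on r S f"
  shows "Ck_on r S (\<lambda>x. L (f x))"
  using assms(3)
proof (induction r arbitrary: f)
  case 0
  then show ?case
    using assms(2) by (simp add: bounded_linear.continuous_on)
next
  case (Suc r)
  show ?case
  proof (rule Ck_on_Suc_I[OF assms(1)])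
    show "((\<lambda>x. L (f x)) has_derivative (\<lambda>v. L (dir_deriv f x v))) (at x)" if "x \<in> S" for x
      by (rule bounded_linear.has_derivative[OF assms(2) Ck_on_Suc_has_derivative[OF Suc.prems that]])
    show "Ck_on r S (\<lambda>x. L (dir_deriv f x v))" for v
      using Suc.prems by (intro Suc.IH) simp
  qed
qed

lemma Ck_on_add:
  assumes "open S" "Ck_on r S f" "Ck_on r S g"
  shows "Ck_on r S (\<lambda>x. f x + g x)"
  using assms(2,3)
proof (induction r arbitrary: f g)
  case 0
  then show ?case by (simp add: continuous_on_add)
next
  case (Suc r)
  show ?case
  proof (rule Ck_on_Suc_I[OF assms(1)])
    show "((\<lambda>x. f x + g x) has_derivative (\<lambda>v. dir_deriv f x v + dir_deriv g x v)) (at x)"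
      if "x \<in> S" for x
      using Suc.prems[THEN Ck_on_Suc_has_derivative, OF that] by (rule has_derivative_add)
    show "Ck_on r S (\<lambda>x. dir_deriv f x v + dir_deriv g x v)" for v
      using Suc.prems by (intro Suc.IH) simp_all
  qed
qed

lemma Ck_on_scaleR:
  assumes "open S" "Ck_on r S f" "Ck_on r S g"
  shows "Ck_on r S (\<lambda>x. f x *\<^sub>R g x)"
  using assms(2,3)
proof (induction r arbitrary: f g)
  case 0
  then show ?case by (simp add: continuous_on_scaleR)
next
  case (Suc r)
  show ?case
  proof (rule Ck_on_Suc_I[OF assms(1)])
    show "((\<lambda>x. f x *\<^sub>R g x) has_derivative
        (\<lambda>v. f x *\<^sub>R dir_deriv g x v + dir_deriv f x v *\<^sub>R g x)) (at x)" if "x \<in> S" for x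
      using Suc.prems[THEN Ck_on_Suc_has_derivative, OF that] by (rule has_derivative_scaleR)
    show "Ck_on r S (\<lambda>x. f x *\<^sub>R dir_deriv g x v + dir_deriv f x v *\<^sub>R g x)" for v
      using Suc.prems Suc.prems[THEN Ck_on_Suc_D]
      by (intro Ck_on_add[OF assms(1)] Suc.IH) simp_all
  qed
qed

lemma Ck_on_sum:
  assumes "open S" "\<And>i. i \<in> I \<Longrightarrow> Ck_on r S (f i)"
  shows "Ck_on r S (\<lambda>x. \<Sum>i\<in>I. f i x)"
  using assms(2)
  by (induction I rule: infinite_finite_induct) (auto intro: Ck_on_const Ck_on_add[OF assms(1)])

lemma Ck_on_inverse:
  fixes f :: "'e::euclidean_space \<Rightarrow> real"
  assumes "open S" "Ck_on r S f" "\<And>x. x \<in> S \<Longrightarrow> f x \<noteq> 0"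
  shows "Ck_on r S (\<lambda>x. inverse (f x))"
  using assms(2)
proof (induction r)
  case 0
  then show ?case using assms(3) by (simp add: continuous_on_inverse)
next
  case (Suc r)
  show ?case
  proof (rule Ck_on_Suc_I[OF assms(1)])
    show "((\<lambda>x. inverse (f x)) has_derivative
        (\<lambda>v. (inverse (f x) *\<^sub>R inverse (f x)) *\<^sub>R - dir_deriv f x v)) (at x)" if "x \<in> S" for x
      using Deriv.has_derivative_inverse[OF assms(3)[OF that] Ck_on_Suc_has_derivative[OF Suc.prems that]]
      by (simp add: mult.commute mult.left_commute)
    have "Ck_on r S (\<lambda>x. inverse (f x))" using Suc Ck_on_Suc_D by blast
    moreover have "Ck_on r S (\<lambda>x. - dir_deriv f x v)" for v
      using Suc.prems
      by (intro Ck_on_linear[OF assms(1) bounded_linear_minus[OF bounded_linear_ident]]) simp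
    ultimately show "Ck_on r S (\<lambda>x. (inverse (f x) *\<^sub>R inverse (f x)) *\<^sub>R - dir_deriv f x v)" for v
      by (intro Ck_on_scaleR[OF assms(1)])
  qed
qed

lemma linear_euclidean_expand:
  fixes L :: "'e::euclidean_space \<Rightarrow> 'f::real_vector"
  assumes "linear L"
  shows "L v = (\<Sum>b\<in>Basis. (v \<bullet> b) *\<^sub>R L b)"
  by (subst euclidean_representation[of v, symmetric])
    (simp only: linear_sum[OF assms] linear_scale[OF assms] o_def)

text \<open>
  Writing the chain rule over a basis turns \<open>D g (f x) (D f x v)\<close> into a sum of products, whose
  factors \<open>D g (f x) b\<close> are again compositions; this is what makes the induction on \<open>r\<close> work.
\<close>

lemma Ck_on_compose:
  fixes f :: "'e::euclidean_space \<Rightarrow> 'd::euclidean_space" and g :: "'d \<Rightarrow> 'f::real_normed_vector"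
  assumes "open S" "open T" "f ` S \<subseteq> T" "Ck_on r S f" "Ck_on r T g"
  shows "Ck_on r S (\<lambda>x. g (f x))"
  using assms(4,5)
proof (induction r arbitrary: g)
  case 0
  then show ?case using assms(3) by (auto intro: continuous_on_compose2)
next
  case (Suc r)
  have gd: "g differentiable (at (f x))" if "x \<in> S" for x
    using Suc.prems that assms(3) by auto
  show ?case
  proof (rule Ck_on_Suc_I[OF assms(1)])
    show "((\<lambda>x. g (f x)) has_derivative
        (\<lambda>v. \<Sum>b\<in>Basis. (dir_deriv f x v \<bullet> b) *\<^sub>R dir_deriv g (f x) b)) (at x)" if "x \<in> S" for x
    proof -
      have "((\<lambda>x. g (f x)) has_derivative (\<lambda>v. dir_deriv g (f x) (dir_deriv f x v))) (at x)"
        using gd[OF that] unfolding frechet_derivative_works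
        by (rule has_derivative_compose[OF Ck_on_Suc_has_derivative[OF Suc.prems(1) that]])
      then show ?thesis
        unfolding linear_euclidean_expand[OF linear_frechet_derivative[OF gd[OF that]],
            of "dir_deriv f x _"] .
    qed
    show "Ck_on r S (\<lambda>x. \<Sum>b\<in>Basis. (dir_deriv f x v \<bullet> b) *\<^sub>R dir_deriv g (f x) b)" for v
    proof (intro Ck_on_sum Ck_on_scaleR assms(1))
      show "Ck_on r S (\<lambda>x. dir_deriv f x v \<bullet> b)" for b
        using Suc.prems by (intro Ck_on_linear[OF assms(1) bounded_linear_inner_left]) auto
      show "Ck_on r S (\<lambda>x. dir_deriv g (f x) b)" for b
        using Suc.IH[of "\<lambda>y. dir_deriv g y b"] Suc.prems Ck_on_Suc_D by auto
    qed
  qed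
qed

lemma smooth_on_cong:
  "open S \<Longrightarrow> smooth_on S f \<Longrightarrow> (\<And>x. x \<in> S \<Longrightarrow> f x = g x) \<Longrightarrow> smooth_on S g"
  unfolding smooth_on_def using Ck_on_cong by blast

lemma smooth_on_subset: "smooth_on S f \<Longrightarrow> T \<subseteq> S \<Longrightarrow> smooth_on T f"
  unfolding smooth_on_def using Ck_on_subset by blast

lemma smooth_on_local:
  "(\<And>x. x \<in> S \<Longrightarrow> \<exists>T. open T \<and> x \<in> T \<and> smooth_on T f) \<Longrightarrow> smooth_on S f"
  unfolding smooth_on_def by (meson Ck_on_local)

lemma smooth_on_const [simp]: "smooth_on S (\<lambda>x. c)"
  by (simp add: smooth_on_def Ck_on_const)

lemma smooth_on_linear:
  "open S \<Longrightarrow> bounded_linear L \<Longrightarrow> smooth_on S f \<Longrightarrow> smooth_on S (\<lambda>x. L (f x))"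
  by (simp add: smooth_on_def Ck_on_linear)

lemma smooth_on_inner_left: "open S \<Longrightarrow> smooth_on S f \<Longrightarrow> smooth_on S (\<lambda>x. f x \<bullet> b)"
  by (rule smooth_on_linear[OF _ bounded_linear_inner_left])

lemma smooth_on_add: "open S \<Longrightarrow> smooth_on S f \<Longrightarrow> smooth_on S g \<Longrightarrow> smooth_on S (\<lambda>x. f x + g x)"
  by (simp add: smooth_on_def Ck_on_add)

lemma smooth_on_scaleR: "open S \<Longrightarrow> smooth_on S f \<Longrightarrow> smooth_on S g \<Longrightarrow> smooth_on S (\<lambda>x. f x *\<^sub>R g x)"
  by (simp add: smooth_on_def Ck_on_scaleR)

lemma smooth_on_mult:
  fixes f g :: "'e::euclidean_space \<Rightarrow> real"
  shows "open S \<Longrightarrow> smooth_on S f \<Longrightarrow> smooth_on S g \<Longrightarrow> smooth_on S (\<lambda>x. f x * g x)"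
  using smooth_on_scaleR[of S f g] by simp

lemma smooth_on_minus: "open S \<Longrightarrow> smooth_on S f \<Longrightarrow> smooth_on S (\<lambda>x. - f x)"
  by (rule smooth_on_linear) (auto intro: bounded_linear_minus bounded_linear_ident)

lemma smooth_on_diff: "open S \<Longrightarrow> smooth_on S f \<Longrightarrow> smooth_on S g \<Longrightarrow> smooth_on S (\<lambda>x. f x - g x)"
  using smooth_on_add[of S f "\<lambda>x. - g x"] smooth_on_minus[of S g] by simp

lemma smooth_on_sum:
  "open S \<Longrightarrow> (\<And>i. i \<in> I \<Longrightarrow> smooth_on S (f i)) \<Longrightarrow> smooth_on S (\<lambda>x. \<Sum>i\<in>I. f i x)"
  by (simp add: smooth_on_def Ck_on_sum)

lemma smooth_on_inverse:
  fixes f :: "'e::euclidean_space \<Rightarrow> real"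
  shows "open S \<Longrightarrow> smooth_on S f \<Longrightarrow> (\<And>x. x \<in> S \<Longrightarrow> f x \<noteq> 0) \<Longrightarrow> smooth_on S (\<lambda>x. inverse (f x))"
  by (simp add: smooth_on_def Ck_on_inverse)

lemma smooth_on_compose:
  fixes f :: "'e::euclidean_space \<Rightarrow> 'd::euclidean_space" and g :: "'d \<Rightarrow> 'f::real_normed_vector"
  shows "open S \<Longrightarrow> open T \<Longrightarrow> f ` S \<subseteq> T \<Longrightarrow> smooth_on S f \<Longrightarrow> smooth_on T g \<Longrightarrow>
    smooth_on S (\<lambda>x. g (f x))"
  unfolding smooth_on_def using Ck_on_compose by blast

lemma smooth_on_differentiable: "smooth_on S f \<Longrightarrow> x \<in> S \<Longrightarrow> f differentiable (at x)"
  unfolding smooth_on_def by (metis Ck_on.simps(2))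

lemma smooth_on_continuous: "smooth_on S f \<Longrightarrow> continuous_on S f"
  unfolding smooth_on_def by (metis Ck_on.simps(1))

lemma smooth_on_dir_deriv: "smooth_on S f \<Longrightarrow> smooth_on S (\<lambda>x. dir_deriv f x v)"
  unfolding smooth_on_def by (metis Ck_on.simps(2))

lemma smooth_on_ident: "open S \<Longrightarrow> smooth_on S (\<lambda>x. x)"
proof -
  assume "open S"
  have "Ck_on r S (\<lambda>x. x)" for r
    by (cases r) (auto simp: Ck_on_const)
  then show ?thesis by (simp add: smooth_on_def)
qed

text \<open>
  The second difference over a parallelogram, evaluated by the mean value theorem first along \<open>u\<close>
  and then along \<open>v\<close>. Its left-hand side is symmetric in \<open>u\<close> and \<open>v\<close>, which gives the symmetry of
  second derivatives.
\<close>

lemma second_difference_mvt: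
  fixes g :: "'e::real_normed_vector \<Rightarrow> real"
  assumes h: "0 < h" "h * (norm u + norm v) < e"
    and d: "\<And>y. y \<in> ball x e \<Longrightarrow> g differentiable (at y)"
    and d2: "\<And>y. y \<in> ball x e \<Longrightarrow> (\<lambda>z. dir_deriv g z u) differentiable (at y)"
  obtains z where "dist z x \<le> h * (norm u + norm v)"
    "g (x + h *\<^sub>R u + h *\<^sub>R v) - g (x + h *\<^sub>R u) - g (x + h *\<^sub>R v) + g x
      = h * h * dir_deriv (\<lambda>z. dir_deriv g z u) z v"
proof -
  have bd: "norm (a *\<^sub>R u + b *\<^sub>R v) \<le> h * (norm u + norm v)" if "0 \<le> a" "a \<le> h" "0 \<le> b" "b \<le> h" for a b
  proof -
    have "norm (a *\<^sub>R u + b *\<^sub>R v) \<le> a * norm u + b * norm v"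
      using norm_triangle_ineq[of "a *\<^sub>R u" "b *\<^sub>R v"] that by simp
    also have "\<dots> \<le> h * norm u + h * norm v"
      using that by (intro add_mono mult_right_mono) auto
    finally show ?thesis by (simp add: distrib_left)
  qed
  have inb: "x + a *\<^sub>R u + b *\<^sub>R v \<in> ball x e" if "0 \<le> a" "a \<le> h" "0 \<le> b" "b \<le> h" for a b
  proof -
    have "dist x (x + a *\<^sub>R u + b *\<^sub>R v) = norm (a *\<^sub>R u + b *\<^sub>R v)"
      by (metis add.assoc add_diff_cancel_left' dist_commute dist_norm)
    then show ?thesis using bd[OF that] h by simp
  qed
  have D: "((\<lambda>a. f (p + a *\<^sub>R w)) has_real_derivative dir_deriv f (p + a *\<^sub>R w) w) (at a)"
    if "f differentiable (at (p + a *\<^sub>R w))" for f :: "'e \<Rightarrow> real" and p w a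
  proof -
    have "(f has_derivative dir_deriv f (p + a *\<^sub>R w)) (at (p + a *\<^sub>R w))"
      using that by (simp add: frechet_derivative_works)
    moreover have "((\<lambda>a. p + a *\<^sub>R w) has_derivative (\<lambda>t. t *\<^sub>R w)) (at a)"
      by (auto intro!: derivative_eq_intros)
    ultimately have "((\<lambda>a. f (p + a *\<^sub>R w)) has_derivative (\<lambda>t. dir_deriv f (p + a *\<^sub>R w) (t *\<^sub>R w))) (at a)"
      using has_derivative_compose by fastforce
    then show ?thesis
      by (simp add: has_field_derivative_def linear_scale[OF linear_frechet_derivative[OF that]] mult.commute[of _ "dir_deriv f (p + a *\<^sub>R w) w"])
  qed
  have "\<exists>a0. 0 < a0 \<and> a0 < h \<and>
     (g (x + h *\<^sub>R v + h *\<^sub>R u) - g (x + h *\<^sub>R u)) - (g (x + h *\<^sub>R v + 0 *\<^sub>R u) - g (x + 0 *\<^sub>R u)) =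
     (h - 0) * (dir_deriv g (x + h *\<^sub>R v + a0 *\<^sub>R u) u - dir_deriv g (x + a0 *\<^sub>R u) u)"
  proof (rule MVT2[OF h(1)])
    fix a :: real assume a: "0 \<le> a" "a \<le> h"
    have 1: "x + h *\<^sub>R v + a *\<^sub>R u \<in> ball x e" "x + a *\<^sub>R u \<in> ball x e"
      using inb[of a h] inb[of a 0] a h(1) by (simp_all add: algebra_simps)
    show "((\<lambda>a. g (x + h *\<^sub>R v + a *\<^sub>R u) - g (x + a *\<^sub>R u)) has_real_derivative
       dir_deriv g (x + h *\<^sub>R v + a *\<^sub>R u) u - dir_deriv g (x + a *\<^sub>R u) u) (at a)"
      by (intro DERIV_diff D d 1)
  qed
  then obtain a0 where a0: "0 < a0" "a0 < h" and e1:
    "(g (x + h *\<^sub>R v + h *\<^sub>R u) - g (x + h *\<^sub>R u)) - (g (x + h *\<^sub>R v + 0 *\<^sub>R u) - g (x + 0 *\<^sub>R u)) =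
     (h - 0) * (dir_deriv g (x + h *\<^sub>R v + a0 *\<^sub>R u) u - dir_deriv g (x + a0 *\<^sub>R u) u)" by auto
  have "\<exists>b0. 0 < b0 \<and> b0 < h \<and>
     dir_deriv g (x + a0 *\<^sub>R u + h *\<^sub>R v) u - dir_deriv g (x + a0 *\<^sub>R u + 0 *\<^sub>R v) u =
     (h - 0) * dir_deriv (\<lambda>z. dir_deriv g z u) (x + a0 *\<^sub>R u + b0 *\<^sub>R v) v"
  proof (rule MVT2[OF h(1)])
    fix b :: real assume b: "0 \<le> b" "b \<le> h"
    have 1: "x + a0 *\<^sub>R u + b *\<^sub>R v \<in> ball x e"
      using inb[of a0 b] a0 b by simp
    show "((\<lambda>b. dir_deriv g (x + a0 *\<^sub>R u + b *\<^sub>R v) u) has_real_derivative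
       dir_deriv (\<lambda>z. dir_deriv g z u) (x + a0 *\<^sub>R u + b *\<^sub>R v) v) (at b)"
      by (rule D[where f="\<lambda>z. dir_deriv g z u"]) (intro d2 1)
  qed
  then obtain b0 where b0: "0 < b0" "b0 < h" and e2:
    "dir_deriv g (x + a0 *\<^sub>R u + h *\<^sub>R v) u - dir_deriv g (x + a0 *\<^sub>R u + 0 *\<^sub>R v) u =
     (h - 0) * dir_deriv (\<lambda>z. dir_deriv g z u) (x + a0 *\<^sub>R u + b0 *\<^sub>R v) v" by auto
  show thesis
  proof
    show "dist (x + a0 *\<^sub>R u + b0 *\<^sub>R v) x \<le> h * (norm u + norm v)"
      using bd[of a0 b0] a0 b0 by (simp add: dist_norm add.assoc)
    have eq: "x + h *\<^sub>R v + h *\<^sub>R u = x + h *\<^sub>R u + h *\<^sub>R v" "x + h *\<^sub>R v + a0 *\<^sub>R u = x + a0 *\<^sub>R u + h *\<^sub>R v"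
      by (simp_all add: algebra_simps)
    show "g (x + h *\<^sub>R u + h *\<^sub>R v) - g (x + h *\<^sub>R u) - g (x + h *\<^sub>R v) + g x
      = h * h * dir_deriv (\<lambda>z. dir_deriv g z u) (x + a0 *\<^sub>R u + b0 *\<^sub>R v) v"
      using e1[unfolded eq] e2 by simp
  qed
qed

text \<open>
  Schwarz's theorem: both mixed derivatives are limits of the same second difference divided by
  \<open>h\<^sup>2\<close>.
\<close>

lemma dir_deriv_commute:
  fixes g :: "'e::euclidean_space \<Rightarrow> real"
  assumes "open S" "x \<in> S" "smooth_on S g"
  shows "dir_deriv (\<lambda>z. dir_deriv g z u) x v = dir_deriv (\<lambda>z. dir_deriv g z v) x u"
proof (rule ccontr)
  define G where "G u v z = dir_deriv (\<lambda>z. dir_deriv g z u) z v" for u v z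
  assume "\<not> ?thesis"
  then have ne: "0 < \<bar>G u v x - G v u x\<bar> / 2" (is "0 < ?\<epsilon>") by (simp add: G_def)
  have cont: "continuous_on S (G u v)" for u v
    unfolding G_def by (intro smooth_on_continuous smooth_on_dir_deriv assms(3))
  have "\<exists>d>0. \<forall>z. dist z x < d \<longrightarrow> dist (G u v z) (G u v x) < ?\<epsilon>" for u v
    using cont[of u v] ne assms(1,2) by (metis continuous_on_eq_continuous_at continuous_at_eps_delta)
  then obtain d1 d2 where d1: "d1 > 0" "\<And>z. dist z x < d1 \<Longrightarrow> dist (G u v z) (G u v x) < ?\<epsilon>"
    and d2: "d2 > 0" "\<And>z. dist z x < d2 \<Longrightarrow> dist (G v u z) (G v u x) < ?\<epsilon>"
    by metis
  obtain d3 where d3: "d3 > 0" "ball x d3 \<subseteq> S" using assms(1,2) openE by blast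
  define e where "e = min d1 (min d2 d3)"
  have e: "e > 0" using d1 d2 d3 by (simp add: e_def)
  define h where "h = e / (norm u + norm v + 1)"
  have pos: "norm u + norm v + 1 > 0" by (smt (verit) norm_ge_zero)
  have h: "0 < h" using e pos by (simp add: h_def)
  have he: "h * (norm u + norm v) < e"
  proof -
    have "h * (norm u + norm v + 1) = e" using pos by (simp add: h_def)
    then show ?thesis using h by (simp add: distrib_left)
  qed
  have sub: "y \<in> S" if "y \<in> ball x e" for y using that d3 by (auto simp: e_def)
  obtain z where z: "dist z x \<le> h * (norm u + norm v)"
    "g (x + h *\<^sub>R u + h *\<^sub>R v) - g (x + h *\<^sub>R u) - g (x + h *\<^sub>R v) + g x = h * h * G u v z"
    unfolding G_def
    by (rule second_difference_mvt[OF h he, of x g])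
      (use sub assms(3) smooth_on_differentiable smooth_on_dir_deriv in blast)+
  have he': "h * (norm v + norm u) < e" using he by (simp add: add.commute)
  obtain z' where z': "dist z' x \<le> h * (norm v + norm u)"
    "g (x + h *\<^sub>R v + h *\<^sub>R u) - g (x + h *\<^sub>R v) - g (x + h *\<^sub>R u) + g x = h * h * G v u z'"
    unfolding G_def
    by (rule second_difference_mvt[OF h he', of x g])
      (use sub assms(3) smooth_on_differentiable smooth_on_dir_deriv in blast)+
  have "x + h *\<^sub>R v + h *\<^sub>R u = x + h *\<^sub>R u + h *\<^sub>R v" by (simp add: algebra_simps)
  then have "h * h * G u v z = h * h * G v u z'" using z(2) z'(2) by (smt (verit))
  then have "G u v z = G v u z'" using h by simp
  moreover have "dist (G u v z) (G u v x) < ?\<epsilon>" using d1(2) z(1) he by (simp add: e_def)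
  moreover have "dist (G v u z') (G v u x) < ?\<epsilon>" using d2(2) z'(1) he' by (simp add: e_def)
  ultimately show False unfolding dist_real_def by (smt (verit, best) field_sum_of_halves)
qed

section \<open>Smooth bump functions\<close>

text \<open>
  The powers of \<open>1/t\<close> in front of \<open>exp (-1/t)\<close> make the linear span of these functions closed under
  differentiation, so that all derivatives are handled by one induction.
\<close>

definition flat :: "nat \<Rightarrow> real \<Rightarrow> real" where
  "flat n t = (if 0 < t then inverse t ^ n * exp (- inverse t) else 0)"

text \<open>
  A quadratic bound gives differentiability at \<open>0\<close>. It comes from
  \<open>exp s = exp (s/m)^m \<ge> (s/m)^m\<close> with \<open>s = 1/t\<close> and \<open>m = n + 2\<close>.
\<close>

lemma flat_le: "\<bar>flat n t\<bar> \<le> real (n + 2) ^ (n + 2) * t ^ 2"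
proof (cases "0 < t")
  case True
  define s where "s = inverse t"
  have s: "s > 0" using True by (simp add: s_def)
  have "(s / (n + 2)) ^ (n + 2) \<le> exp (s / (n + 2)) ^ (n + 2)"
    using s exp_ge_add_one_self[of "s / (n + 2)"] by (intro power_mono) (simp_all add: order_trans[OF _ exp_ge_add_one_self])
  also have "\<dots> = exp s" by (subst exp_of_nat_mult[symmetric]) simp
  finally have "s ^ (n + 2) \<le> real (n + 2) ^ (n + 2) * exp s"
    by (simp add: power_divide divide_le_eq mult.commute)
  then have "s ^ n * exp (- s) * s ^ 2 \<le> real (n + 2) ^ (n + 2)"
    by (simp add: exp_minus divide_simps power_add mult.commute mult.left_commute power2_eq_square del: of_nat_add)
  moreover have "s * t = 1" using True by (simp add: s_def)
  then have "s ^ 2 * t ^ 2 = 1" by (metis power_mult_distrib power_one)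
  ultimately have "s ^ n * exp (- s) \<le> real (n + 2) ^ (n + 2) * t ^ 2"
    using mult_right_mono[of "s ^ n * exp (- s) * s ^ 2" "real (n + 2) ^ (n + 2)" "t ^ 2"]
    by (metis mult.assoc mult.right_neutral zero_le_power2)
  moreover have "flat n t = s ^ n * exp (- s)" "0 \<le> s ^ n * exp (- s)"
    using True s by (simp_all add: flat_def s_def)
  ultimately show ?thesis by simp
qed (simp add: flat_def)

lemma flat_deriv:
  "(flat n has_real_derivative flat (n + 2) t - real n * flat (n + 1) t) (at t)"
proof -
  consider "t < 0" | "t = 0" | "t > 0" by linarith
  then show ?thesis
  proof cases
    case 1
    then have "((\<lambda>_. 0) has_real_derivative flat (n + 2) t - real n * flat (n + 1) t) (at t)"
      by (simp add: flat_def)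
    then show ?thesis
      by (rule has_field_derivative_transform_within_open[where S="{..<0}"]) (use 1 in \<open>auto simp: flat_def\<close>)
  next
    case 2
    have "((\<lambda>h. (flat n (0 + h) - flat n 0) / h) \<longlongrightarrow> 0) (at 0)"
    proof (rule Lim_null_comparison)
      show "\<forall>\<^sub>F h in at 0. norm ((flat n (0 + h) - flat n 0) / h) \<le> real (n + 2) ^ (n + 2) * \<bar>h\<bar>"
        unfolding eventually_at
      proof (intro exI[of _ 1] conjI ballI impI)
        fix h :: real assume "h \<noteq> 0 \<and> dist h 0 < 1"
        then show "norm ((flat n (0 + h) - flat n 0) / h) \<le> real (n + 2) ^ (n + 2) * \<bar>h\<bar>"
          using flat_le[of n h]
          by (simp add: flat_def[of n 0] divide_le_eq mult.assoc power2_eq_square del: of_nat_add)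
      qed simp
      have "((\<lambda>h::real. real (n + 2) ^ (n + 2) * \<bar>h\<bar>) \<longlongrightarrow> real (n + 2) ^ (n + 2) * \<bar>0\<bar>) (at 0)"
        by (intro tendsto_intros)
      then show "((\<lambda>h::real. real (n + 2) ^ (n + 2) * \<bar>h\<bar>) \<longlongrightarrow> 0) (at 0)" by simp
    qed
    then show ?thesis using 2 by (simp add: DERIV_def flat_def)
  next
    case 3
    have "((\<lambda>t. inverse t ^ n * exp (- inverse t)) has_real_derivative
        flat (n + 2) t - real n * flat (n + 1) t) (at t)"
      using 3
      by (cases n) (auto intro!: derivative_eq_intros simp: flat_def field_simps power2_eq_square,
          metis One_nat_def power_eq_if)
    then show ?thesis
      by (rule has_field_derivative_transform_within_open[where S="{0<..}"]) (use 3 in \<open>auto simp: flat_def\<close>)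
  qed
qed

lemma smooth_on_flat: "smooth_on UNIV (flat n)"
proof -
  have "Ck_on r UNIV (flat n)" for r
  proof (induction r arbitrary: n)
    case 0
    show ?case
      using flat_deriv by (auto intro!: DERIV_isCont continuous_at_imp_continuous_on)
  next
    case (Suc r)
    show ?case
    proof (rule Ck_on_Suc_I)
      show "(flat n has_derivative (\<lambda>v. v *\<^sub>R (flat (n + 2) t + (- real n) *\<^sub>R flat (n + 1) t))) (at t)" for t
        using flat_deriv[of n t] unfolding has_field_derivative_def
        by (simp add: mult.commute[of _ "_ - _"])
      show "Ck_on r UNIV (\<lambda>t. v *\<^sub>R (flat (n + 2) t + (- real n) *\<^sub>R flat (n + 1) t))" for v :: real
        by (intro Ck_on_scaleR Ck_on_add Ck_on_const Suc.IH open_UNIV)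
    qed simp
  qed
  then show ?thesis by (simp add: smooth_on_def)
qed

definition bump :: "'e::euclidean_space \<Rightarrow> real \<Rightarrow> 'e \<Rightarrow> real" where
  "bump y0 r y = flat 0 (r\<^sup>2 - (y - y0) \<bullet> (y - y0))"

lemma bump_outside: "y \<notin> cball y0 r \<Longrightarrow> 0 < r \<Longrightarrow> bump y0 r y = 0"
  using power_strict_mono[of r "norm (y - y0)" 2]
  by (auto simp: bump_def flat_def dist_norm norm_minus_commute power2_norm_eq_inner[symmetric])

lemma bump_center: "0 < r \<Longrightarrow> 0 < bump y0 r y0"
  by (simp add: bump_def flat_def)

lemma smooth_on_bump: "smooth_on UNIV (bump y0 r)"
proof -
  have s: "smooth_on UNIV (\<lambda>y. (y - y0) \<bullet> b)" for b :: 'a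
    by (intro smooth_on_inner_left smooth_on_diff smooth_on_ident smooth_on_const open_UNIV)
  have "smooth_on UNIV (\<lambda>y. r\<^sup>2 - (\<Sum>b\<in>Basis. ((y - y0) \<bullet> b) * ((y - y0) \<bullet> b)))"
    by (intro smooth_on_diff smooth_on_sum smooth_on_mult s open_UNIV smooth_on_const)
  then have "smooth_on UNIV (\<lambda>y. flat 0 (r\<^sup>2 - (\<Sum>b\<in>Basis. ((y - y0) \<bullet> b) * ((y - y0) \<bullet> b))))"
    by (intro smooth_on_compose[OF open_UNIV open_UNIV _ _ smooth_on_flat]) auto
  then show ?thesis
    unfolding bump_def by (simp add: euclidean_inner[of "_ - _" "_ - _"])
qed

section \<open>Alternating forms\<close>

lemma alternating_length: "alternating k f \<Longrightarrow> length vs \<noteq> k \<Longrightarrow> f vs = 0"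
  by (simp add: alternating_def)

lemma alternating_linear:
  assumes "alternating k f" "length p + length q + 1 = k"
  shows "linear (\<lambda>v. f (p @ v # q))"
proof -
  have "linear (\<lambda>v. f ((p @ 0 # q)[length p := v]))"
    using assms unfolding alternating_def by (simp del: list_update_length)
  then show ?thesis by simp
qed

lemma alternating_repeat:
  assumes "alternating k f"
  shows "f (p @ v # q @ v # r) = 0"
proof (cases "length (p @ v # q @ v # r) = k")
  case True
  have "\<forall>vs i j. length vs = k \<and> i < j \<and> j < k \<and> vs ! i = vs ! j \<longrightarrow> f vs = 0"
    using assms unfolding alternating_def by blast
  from this[rule_format, of "p @ v # q @ v # r" "length p" "length p + length q + 1"]
  show ?thesis using True by (auto simp: nth_append)
qed (use assms in \<open>rule alternating_length\<close>)

lemma alternating_I: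
  fixes f :: "'e::real_vector covector"
  assumes "\<And>vs. length vs \<noteq> k \<Longrightarrow> f vs = 0"
    and lin: "\<And>p q. length p + length q + 1 = k \<Longrightarrow> linear (\<lambda>v. f (p @ v # q))"
    and rep: "\<And>p v q r. length p + length q + length r + 2 = k \<Longrightarrow> f (p @ v # q @ v # r) = 0"
  shows "alternating k f"
  unfolding alternating_def
proof (intro conjI allI impI)
  show "f vs = 0" if "length vs \<noteq> k" for vs using assms(1) that by simp
next
  fix vs :: "'e list" and i assume "length vs = k \<and> i < k"
  then show "linear (\<lambda>v. f (vs[i := v]))"
    using lin[of "take i vs" "drop (Suc i) vs"] by (simp add: upd_conv_take_nth_drop)
next
  fix vs :: "'e list" and i j assume a: "length vs = k \<and> i < j \<and> j < k \<and> vs ! i = vs ! j"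
  define q where "q = take (j - Suc i) (drop (Suc i) vs)"
  have "drop (Suc i) vs = q @ drop (j - Suc i) (drop (Suc i) vs)"
    unfolding q_def by (metis append_take_drop_id)
  also have "drop (j - Suc i) (drop (Suc i) vs) = vs ! j # drop (Suc j) vs"
    using a by (simp add: Cons_nth_drop_Suc)
  finally have dec: "take i vs @ vs ! i # q @ vs ! i # drop (Suc j) vs = vs"
    using a id_take_nth_drop[of i vs] by simp
  have "length (take i vs) + length q + length (drop (Suc j) vs) + 2 = k"
    using a by (auto simp: q_def)
  from rep[OF this, of "vs ! i"] show "f vs = 0" unfolding dec .
qed

lemma alternating_swap:
  assumes "alternating k f"
  shows "f (p @ a # b # q) = - f (p @ b # a # q)"
proof (cases "length p + length q + 2 = k")
  case True
  have l1: "linear (\<lambda>v. f (p @ v # c # q))" for c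
    using alternating_linear[OF assms, of p "c # q"] True by simp
  have l2: "linear (\<lambda>v. f (p @ c # v # q))" for c
    using alternating_linear[OF assms, of "p @ [c]" q] True by simp
  have z: "f (p @ c # c # q) = 0" for c
    using alternating_repeat[OF assms, of p c "[]" q] by simp
  have "0 = f (p @ (a + b) # (a + b) # q)" by (simp add: z)
  also have "\<dots> = f (p @ a # b # q) + f (p @ b # a # q)"
    unfolding linear_add[OF l1] linear_add[OF l2] by (simp add: z)
  finally show ?thesis by linarith
next
  case False
  then show ?thesis using alternating_length[OF assms] by simp
qed

lemma alternating_move:
  assumes "alternating k f"
  shows "f (p @ q @ v # r) = (-1) ^ length q * f (p @ v # q @ r)"
proof (induction q arbitrary: p)
  case (Cons a q)
  have "f (p @ (a # q) @ v # r) = (-1) ^ length q * f ((p @ [a]) @ v # q @ r)"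
    using Cons[of "p @ [a]"] by simp
  also have "f ((p @ [a]) @ v # q @ r) = - f (p @ v # a # q @ r)"
    using alternating_swap[OF assms, of p a v] by simp
  finally show ?case by simp
qed simp

lemma alternating_pullback:
  assumes "alternating k f" "linear T"
  shows "alternating k (\<lambda>vs. f (map T vs))"
proof (rule alternating_I)
  show "linear (\<lambda>v. f (map T (p @ v # q)))" if "length p + length q + 1 = k" for p q
    using linear_compose[OF assms(2) alternating_linear[OF assms(1), of "map T p" "map T q"]] that
    by (simp add: o_def)
qed (simp_all add: alternating_length[OF assms(1)] alternating_repeat[OF assms(1)])

lemma alternating_expand:
  fixes f :: "'e::euclidean_space covector"
  assumes "alternating k f" "length p + length q + 1 = k"
  shows "f (p @ v # q) = (\<Sum>b\<in>Basis. (v \<bullet> b) * f (p @ b # q))"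
  using linear_euclidean_expand[OF alternating_linear[OF assms], of v] by simp

text \<open>
  The entries are replaced by basis vectors one at a time, so the induction is over the part \<open>us\<close>
  that has not been treated yet.
\<close>

lemma alternating_zero_if_zero_on_Basis:
  fixes f :: "'e::euclidean_space covector"
  assumes "alternating k f" "\<And>l. length l = k \<Longrightarrow> set l \<subseteq> Basis \<Longrightarrow> f l = 0"
  shows "f vs = 0"
proof -
  have "f (p @ us) = 0" if "set p \<subseteq> Basis" "length p + length us = k" for p us
    using that
  proof (induction us arbitrary: p)
    case Nil
    then show ?case using assms(2) by simp
  next
    case (Cons u us)
    have "f (p @ b # us) = 0" if "b \<in> Basis" for b
      using Cons.IH[of "p @ [b]"] Cons.prems that by simp
    then show ?case using Cons.prems by (subst alternating_expand[OF assms(1)]) simp_all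
  qed
  from this[of "[]" vs] show ?thesis using alternating_length[OF assms(1)] by fastforce
qed

text \<open>
  An alternating form applied to smooth vector functions is a polynomial in their coordinates.
\<close>

lemma smooth_on_alternating_eval:
  fixes f :: "'e::euclidean_space covector" and us :: "('d::euclidean_space \<Rightarrow> 'e) list"
  assumes "open S" "alternating k f" "\<And>u. u \<in> set us \<Longrightarrow> smooth_on S u"
  shows "smooth_on S (\<lambda>y. f (map (\<lambda>u. u y) us))"
proof (cases "length us = k")
  case True
  have "smooth_on S (\<lambda>y. f (p @ map (\<lambda>u. u y) us))"
    if "length p + length us = k" "\<And>u. u \<in> set us \<Longrightarrow> smooth_on S u" for p us
    using that
  proof (induction us arbitrary: p)
    case (Cons u us)
    have "smooth_on S (\<lambda>y. f ((p @ [b]) @ map (\<lambda>u. u y) us))" for b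
      using Cons.prems by (intro Cons.IH) simp_all
    then have "smooth_on S (\<lambda>y. \<Sum>b\<in>Basis. (u y \<bullet> b) * f (p @ b # map (\<lambda>u. u y) us))"
      using Cons.prems
      by (intro smooth_on_sum smooth_on_mult smooth_on_inner_left assms(1)) simp_all
    then show ?case using Cons.prems by (simp add: alternating_expand[OF assms(2), of p])
  qed simp
  from this[of "[]" us] True assms(3) show ?thesis by simp
qed (simp add: alternating_length[OF assms(2)])

section \<open>Exterior derivative in coordinates\<close>

text \<open>
  The terms of the coordinate formula for the exterior derivative in which an entry of \<open>vs\<close> is
  omitted, while the surrounding entries \<open>p\<close> and \<open>r\<close> stay in place. Signs are counted from the
  beginning of \<open>vs\<close>. With \<open>p = r = []\<close> it is the whole exterior derivative; the two extra arguments
  allow the sum to be split where two entries coincide.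
\<close>

definition ext_terms ::
    "('e::real_normed_vector \<Rightarrow> 'e covector) \<Rightarrow> 'e \<Rightarrow> 'e list \<Rightarrow> 'e list \<Rightarrow> 'e list \<Rightarrow> real" where
  "ext_terms F y p vs r =
     (\<Sum>i<length vs. (-1) ^ i * dir_deriv (\<lambda>y. F y (p @ take i vs @ drop (Suc i) vs @ r)) y (vs ! i))"

lemma ext_terms_Nil [simp]: "ext_terms F y p [] r = 0"
  by (simp add: ext_terms_def)

lemma ext_terms_Cons:
  "ext_terms F y p (v # vs) r =
     dir_deriv (\<lambda>y. F y (p @ vs @ r)) y v - ext_terms F y (p @ [v]) vs r"
  unfolding ext_terms_def length_Cons sum.lessThan_Suc_shift
  by (simp add: sum_negf[symmetric])

lemma ext_terms_append:
  "ext_terms F y p (us @ vs) r =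
     ext_terms F y p us (vs @ r) + (-1) ^ length us * ext_terms F y (p @ us) vs r"
  by (induction us arbitrary: p) (auto simp: ext_terms_Cons algebra_simps)

lemma dir_deriv_eq_zero:
  assumes "open S" "y0 \<in> S" "\<And>y. y \<in> S \<Longrightarrow> f y = 0"
  shows "dir_deriv f y0 v = 0"
proof -
  have "dir_deriv (\<lambda>y. 0) y0 = dir_deriv f y0"
    using assms by (intro frechet_derivative_transform_within_open) auto
  then show ?thesis by (metis frechet_derivative_const)
qed

lemma linear_dir_deriv_parameter:
  fixes G :: "'e::real_normed_vector \<Rightarrow> 'd::real_vector \<Rightarrow> real"
  assumes S: "open S" "y0 \<in> S" and lin: "\<And>y. y \<in> S \<Longrightarrow> linear (G y)"
    and d: "\<And>v. (\<lambda>y. G y v) differentiable (at y0)"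
  shows "linear (\<lambda>v. dir_deriv (\<lambda>y. G y v) y0 w)"
proof (rule linearI)
  have h: "((\<lambda>y. G y v) has_derivative dir_deriv (\<lambda>y. G y v) y0) (at y0)" for v
    using d by (simp add: frechet_derivative_works)
  fix u v :: 'd and c :: real
  have "((\<lambda>y. G y (u + v)) has_derivative
      (\<lambda>w. dir_deriv (\<lambda>y. G y u) y0 w + dir_deriv (\<lambda>y. G y v) y0 w)) (at y0)"
    by (rule has_derivative_transform_within_open[OF has_derivative_add[OF h[of u] h[of v]] S])
      (simp add: linear_add[OF lin])
  from frechet_derivative_at[OF this]
  show "dir_deriv (\<lambda>y. G y (u + v)) y0 w = dir_deriv (\<lambda>y. G y u) y0 w + dir_deriv (\<lambda>y. G y v) y0 w"
    by metis
  have "((\<lambda>y. G y (c *\<^sub>R v)) has_derivative (\<lambda>w. c *\<^sub>R dir_deriv (\<lambda>y. G y v) y0 w)) (at y0)"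
    by (rule has_derivative_transform_within_open[OF has_derivative_scaleR_right[OF h[of v]] S])
      (simp add: linear_scale[OF lin])
  from frechet_derivative_at[OF this]
  show "dir_deriv (\<lambda>y. G y (c *\<^sub>R v)) y0 w = c *\<^sub>R dir_deriv (\<lambda>y. G y v) y0 w"
    by metis
qed

lemma linear_cmult_left: "linear f \<Longrightarrow> linear (\<lambda>x. c * f x :: real)"
  using linear_compose_scale_right[of f c] by simp

text \<open>
  For a list \<open>p @ v # q @ v # r\<close> all terms that keep both copies of \<open>v\<close> vanish. The two remaining
  ones, in which one copy is omitted, differ by moving \<open>v\<close> across \<open>q\<close> and cancel.
\<close>

lemma alternating_ext_terms:
  fixes F :: "'e::real_normed_vector \<Rightarrow> 'e covector"
  assumes S: "open S" "y0 \<in> S" and alt: "\<And>y. y \<in> S \<Longrightarrow> alternating k (F y)"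
    and d: "\<And>vs. (\<lambda>y. F y vs) differentiable (at y0)"
  shows "alternating (Suc k) (\<lambda>vs. ext_terms F y0 [] vs [])"
proof (rule alternating_I)
  fix vs :: "'e list" assume "length vs \<noteq> Suc k"
  then show "ext_terms F y0 [] vs [] = 0"
    unfolding ext_terms_def
    by (intro sum.neutral ballI)
      (simp add: dir_deriv_eq_zero[OF S] alternating_length[OF alt])
next
  fix p q :: "'e list" assume len: "length p + length q + 1 = Suc k"
  have L: "linear (\<lambda>v. dir_deriv (\<lambda>y. F y (p' @ v # q')) y0 w)" if "Suc (length p' + length q') = k" for p' q' w
    using that by (intro linear_dir_deriv_parameter[OF S] d alternating_linear[OF alt]) simp_all
  have "linear (\<lambda>v. ext_terms F y0 [] p (v # q))"
    unfolding ext_terms_def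
    by (intro linear_compose_sum ballI linear_cmult_left)
      (use len in \<open>auto intro!: L[of "[] @ take _ _ @ drop _ _", simplified]\<close>)
  moreover have "linear (\<lambda>v. ext_terms F y0 (p @ [v]) q [])"
    unfolding ext_terms_def
    by (intro linear_compose_sum ballI linear_cmult_left)
      (use len in \<open>auto intro!: L\<close>)
  moreover have "linear (dir_deriv (\<lambda>y. F y (p @ q)) y0)"
    by (rule linear_frechet_derivative[OF d])
  ultimately have "linear (\<lambda>v. ext_terms F y0 [] p (v # q)
      + (-1) ^ length p *\<^sub>R (dir_deriv (\<lambda>y. F y (p @ q)) y0 v - ext_terms F y0 (p @ [v]) q []))"
    by (intro linear_compose_add linear_compose_scale_right linear_compose_sub)
  then show "linear (\<lambda>v. ext_terms F y0 [] (p @ v # q) [])"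
    by (simp add: ext_terms_append ext_terms_Cons)
next
  fix p q r :: "'e list" and v
  assume len: "length p + length q + length r + 2 = Suc k"
  have z: "dir_deriv (\<lambda>y. F y (p' @ v # q' @ v # r')) y0 w = 0" for p' q' r' w
    by (rule dir_deriv_eq_zero[OF S]) (rule alternating_repeat[OF alt])
  have "ext_terms F y0 [] p (v # q @ v # r) = 0"
    unfolding ext_terms_def
    by (intro sum.neutral) (use z[of "take _ p @ drop _ p"] in simp)
  moreover have "ext_terms F y0 (p @ [v]) q (v # r) = 0"
    unfolding ext_terms_def
    by (intro sum.neutral) (use z[of p "take _ q @ drop _ q"] in simp)
  moreover have "ext_terms F y0 (p @ v # q @ [v]) r [] = 0"
    unfolding ext_terms_def
    by (intro sum.neutral) (use z[of p q] in simp)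
  moreover have "dir_deriv (\<lambda>y. F y (p @ q @ v # r)) y0 v
      = (-1) ^ length q * dir_deriv (\<lambda>y. F y (p @ v # q @ r)) y0 v"
  proof -
    have h: "((\<lambda>y. F y (p @ v # q @ r)) has_derivative dir_deriv (\<lambda>y. F y (p @ v # q @ r)) y0) (at y0)"
      using d by (simp add: frechet_derivative_works)
    have "((\<lambda>y. F y (p @ q @ v # r)) has_derivative
        (\<lambda>w. (-1) ^ length q *\<^sub>R dir_deriv (\<lambda>y. F y (p @ v # q @ r)) y0 w)) (at y0)"
      by (rule has_derivative_transform_within_open[OF has_derivative_scaleR_right[OF h] S])
        (simp add: alternating_move[OF alt, of _ p q])
    from frechet_derivative_at[OF this] show ?thesis by (metis real_scaleR_def)
  qed
  ultimately show "ext_terms F y0 [] (p @ v # q @ v # r) [] = 0"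
    by (simp add: ext_terms_append ext_terms_Cons)
qed

section \<open>Covectors as contractions\<close>

text \<open>
  The transpose of an injective linear map is surjective. The vector
  \<open>\<Sum>b\<in>Basis. f (l @ [b]) *\<^sub>R b\<close> represents the covector obtained by inserting \<open>l\<close> into \<open>f\<close>; for a
  vector \<open>v\<close> orthogonal to all of these, \<open>f (v # us)\<close> vanishes for every \<open>us\<close>.
\<close>

lemma contraction_surjective:
  fixes f :: "'e::euclidean_space covector"
  assumes alt: "alternating (Suc m) f" and nondeg: "\<And>v. (\<And>us. f (v # us) = 0) \<Longrightarrow> v = 0"
  shows "\<exists>\<xi>. v = (\<Sum>l\<in>{l. set l \<subseteq> Basis \<and> length l = m}. \<xi> l *\<^sub>R (\<Sum>b\<in>Basis. f (l @ [b]) *\<^sub>R b))"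
proof -
  define J where "J = {l :: 'e list. set l \<subseteq> Basis \<and> length l = m}"
  define t where "t l = (\<Sum>b\<in>Basis. f (l @ [b]) *\<^sub>R b)" for l
  have finJ: "finite J" unfolding J_def by (intro finite_lists_length_eq finite_Basis)
  define R where "R = range (\<lambda>\<xi>. \<Sum>l\<in>J. \<xi> l *\<^sub>R t l)"
  have t: "t l \<bullet> v = f (l @ [v])" if "l \<in> J" for l v
    using alternating_expand[OF alt, of l "[]" v] that
    by (simp add: t_def J_def inner_sum_left inner_sum_right inner_commute mult.commute)
  have sub: "subspace R"
    unfolding R_def
  proof (rule subspaceI)
    show "0 \<in> range (\<lambda>\<xi>. \<Sum>l\<in>J. \<xi> l *\<^sub>R t l)" by (rule range_eqI[of _ _ "\<lambda>_. 0"]) simp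
    show "x + y \<in> range (\<lambda>\<xi>. \<Sum>l\<in>J. \<xi> l *\<^sub>R t l)"
      if "x \<in> range (\<lambda>\<xi>. \<Sum>l\<in>J. \<xi> l *\<^sub>R t l)" "y \<in> range (\<lambda>\<xi>. \<Sum>l\<in>J. \<xi> l *\<^sub>R t l)" for x y
      using that by (auto simp: sum.distrib[symmetric] scaleR_add_left[symmetric])
    show "c *\<^sub>R x \<in> range (\<lambda>\<xi>. \<Sum>l\<in>J. \<xi> l *\<^sub>R t l)"
      if "x \<in> range (\<lambda>\<xi>. \<Sum>l\<in>J. \<xi> l *\<^sub>R t l)" for x c
      using that by (auto simp: scaleR_sum_right)
  qed
  have tR: "t l \<in> R" if "l \<in> J" for l
    unfolding R_def
    by (rule range_eqI[of _ _ "\<lambda>l'. if l' = l then 1 else 0"])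
      (use finJ that in \<open>simp add: if_distrib[of "\<lambda>c. c *\<^sub>R _"] sum.delta cong: if_cong\<close>)
  have "R = UNIV"
  proof (rule ccontr)
    assume "R \<noteq> UNIV"
    then have "span R \<subset> span UNIV" using sub by (simp add: span_eq_iff[THEN iffD2] psubset_eq)
    then obtain v where v: "v \<noteq> 0" "\<And>x. x \<in> span R \<Longrightarrow> orthogonal v x"
      by (rule orthogonal_to_subspace_exists_gen) (blast intro: that)
    have z: "f (v # l) = 0" if "l \<in> J" for l
    proof -
      have "f (l @ [v]) = 0"
        using v(2)[of "t l"] t[OF that, of v] tR[OF that]
        by (simp add: orthogonal_def inner_commute span_base)
      then show ?thesis using alternating_move[OF alt, of "[]" l v "[]"] by simp
    qed
    have "alternating m (\<lambda>us. f (v # us))"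
    proof (rule alternating_I)
      show "linear (\<lambda>w. f (v # p @ w # q))" if "length p + length q + 1 = m" for p q
        using alternating_linear[OF alt, of "v # p" q] that by simp
      show "f (v # p @ w # q @ w # r) = 0" for p w q r
        using alternating_repeat[OF alt, of "v # p" w q r] by simp
    qed (simp add: alternating_length[OF alt])
    from alternating_zero_if_zero_on_Basis[OF this] z have "f (v # us) = 0" for us
      unfolding J_def by blast
    then show False using nondeg v(1) by blast
  qed
  then have "v \<in> R" by simp
  then show ?thesis by (auto simp: R_def J_def t_def)
qed

text \<open>
  Smooth functions \<open>t j\<close> that span the space at one point express the constant basis vectors, with
  smooth coefficients, on a neighbourhood. The coefficients are built by Gauss elimination, one basis
  vector at a time: the only divisions are by functions that take the value \<open>1\<close> at \<open>y0\<close>.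
\<close>

lemma smooth_dual_frame:
  fixes t :: "'j \<Rightarrow> 'e::euclidean_space \<Rightarrow> 'e"
  assumes S: "open S" "y0 \<in> S" and t: "\<And>j. j \<in> J \<Longrightarrow> smooth_on S (t j)"
    and onto: "\<And>v. \<exists>\<xi>. v = (\<Sum>j\<in>J. \<xi> j *\<^sub>R t j y0)"
  obtains T a where "open T" "y0 \<in> T" "T \<subseteq> S" "\<And>b j. b \<in> Basis \<Longrightarrow> j \<in> J \<Longrightarrow> smooth_on T (a b j)"
    "\<And>b y. b \<in> Basis \<Longrightarrow> y \<in> T \<Longrightarrow> (\<Sum>j\<in>J. a b j y *\<^sub>R t j y) = b"
proof -
  define comb where "comb a y = (\<Sum>j\<in>J. a j y *\<^sub>R t j y)" for a :: "'j \<Rightarrow> 'e \<Rightarrow> real" and y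
  have sm: "smooth_on T (comb a)" if "open T" "T \<subseteq> S" "\<And>j. j \<in> J \<Longrightarrow> smooth_on T (a j)" for T a
    unfolding comb_def using that t by (auto intro!: smooth_on_sum smooth_on_scaleR intro: smooth_on_subset)
  have "\<exists>T a. open T \<and> y0 \<in> T \<and> T \<subseteq> S \<and> (\<forall>b\<in>B. \<forall>j\<in>J. smooth_on T (a b j)) \<and>
      (\<forall>b\<in>B. \<forall>b'\<in>B. \<forall>y\<in>T. comb (a b) y \<bullet> b' = (if b = b' then 1 else 0))"
    if "finite B" "B \<subseteq> Basis" for B
    using that
  proof (induction B rule: finite_induct)
    case empty
    then show ?case using S by auto
  next
    case (insert b0 B)
    have "\<exists>T a. open T \<and> y0 \<in> T \<and> T \<subseteq> S \<and> (\<forall>b\<in>B. \<forall>j\<in>J. smooth_on T (a b j)) \<and>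
      (\<forall>b\<in>B. \<forall>b'\<in>B. \<forall>y\<in>T. comb (a b) y \<bullet> b' = (if b = b' then 1 else 0))"
      using insert.prems by (intro insert.IH) simp
    then obtain T a where T: "open T" "y0 \<in> T" "T \<subseteq> S"
      and a': "\<forall>b\<in>B. \<forall>j\<in>J. smooth_on T (a b j)"
      and dual': "\<forall>b\<in>B. \<forall>b'\<in>B. \<forall>y\<in>T. comb (a b) y \<bullet> b' = (if b = b' then 1 else 0)"
      by (elim exE conjE) (rule that)
    note a = a'[rule_format] and dual = dual'[rule_format]
    obtain \<xi> where \<xi>: "b0 = (\<Sum>j\<in>J. \<xi> j *\<^sub>R t j y0)" using onto by blast
    define u where "u = comb (\<lambda>j y. \<xi> j)"
    \<comment> \<open>subtracting its components along \<open>B\<close> from \<open>u\<close> keeps the value \<open>b0\<close> at \<open>y0\<close>\<close>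
    define c where "c j y = \<xi> j - (\<Sum>b\<in>B. (u y \<bullet> b) * a b j y)" for j y
    have u: "smooth_on T u" unfolding u_def using T by (intro sm) simp_all
    have c: "smooth_on T (c j)" if "j \<in> J" for j
      unfolding c_def using T a u that
      by (intro smooth_on_diff smooth_on_sum smooth_on_mult smooth_on_inner_left smooth_on_const) simp_all
    have comb_c: "comb c y = u y - (\<Sum>b\<in>B. (u y \<bullet> b) *\<^sub>R comb (a b) y)" for y
      unfolding comb_def c_def u_def
      by (simp add: scaleR_diff_left sum_subtractf scaleR_sum_left scaleR_sum_right)
        (subst sum.swap, simp)
    have c0: "comb c y \<bullet> b' = 0" if "y \<in> T" "b' \<in> B" for y b'
    proof -
      have "(\<Sum>b\<in>B. (u y \<bullet> b) *\<^sub>R comb (a b) y) \<bullet> b' = (\<Sum>b\<in>B. if b = b' then u y \<bullet> b else 0)"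
        unfolding inner_sum_left by (rule sum.cong) (simp_all add: dual that)
      then show ?thesis using that insert.hyps(1) by (simp add: comb_c inner_diff_left)
    qed
    define D where "D y = comb c y \<bullet> b0" for y
    have D: "smooth_on T D" unfolding D_def using T c by (intro smooth_on_inner_left sm) simp_all
    have "u y0 = b0" by (simp add: u_def comb_def \<xi>[symmetric])
    then have "comb c y0 = b0"
      using insert.hyps(2) insert.prems
      by (simp add: comb_c) (rule sum.neutral, auto simp: inner_Basis subset_iff)
    then have D0: "D y0 = 1" using insert.prems by (simp add: D_def)
    define T' where "T' = {y \<in> T. D y \<noteq> 0}"
    have "open T'"
    proof -
      have "T' = T \<inter> D -` (- {0})" by (auto simp: T'_def)
      then show ?thesis
        using continuous_open_preimage[OF smooth_on_continuous[OF D] T(1), of "- {0}"] by (simp add: open_Compl)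
    qed
    have T': "open T'" "y0 \<in> T'" "T' \<subseteq> S" "T' \<subseteq> T"
      using T D0 \<open>open T'\<close> by (auto simp: T'_def)
    define c' where "c' j y = inverse (D y) * c j y" for j y
    have comb_c': "comb c' y = inverse (D y) *\<^sub>R comb c y" for y
      by (simp add: comb_def c'_def scaleR_sum_right)
    have sc': "smooth_on T' (c' j)" if "j \<in> J" for j
      unfolding c'_def using T' smooth_on_subset[OF D T'(4)] smooth_on_subset[OF c[OF that] T'(4)]
      by (intro smooth_on_mult smooth_on_inverse) (auto simp: T'_def)
    \<comment> \<open>the coefficients already found are corrected to have no component along \<open>b0\<close>\<close>
    define a' where "a' b = (if b = b0 then c' else (\<lambda>j y. a b j y - (comb (a b) y \<bullet> b0) * c' j y))" for b
    have comb_a': "comb (a' b) y = comb (a b) y - (comb (a b) y \<bullet> b0) *\<^sub>R comb c' y" if "b \<noteq> b0" for b y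
      using that by (simp add: comb_def a'_def scaleR_diff_left sum_subtractf scaleR_sum_right)
    have sa: "smooth_on T' (a b j)" if "b \<in> B" "j \<in> J" for b j
      using a[OF that] T'(4) smooth_on_subset by blast
    have F1: "smooth_on T' (a' b j)" if "b \<in> insert b0 B" "j \<in> J" for b j
    proof (cases "b = b0")
      case True
      then show ?thesis using sc' that by (simp add: a'_def)
    next
      case False
      then have "b \<in> B" using that by simp
      then have "smooth_on T' (\<lambda>y. a b j y - (comb (a b) y \<bullet> b0) * c' j y)"
        using T' sc' sa that
        by (intro smooth_on_diff smooth_on_mult smooth_on_inner_left sm) simp_all
      then show ?thesis using False by (simp add: a'_def)
    qed
    have F2: "comb (a' b) y \<bullet> b' = (if b = b' then 1 else 0)"
      if "b \<in> insert b0 B" "b' \<in> insert b0 B" "y \<in> T'" for b b' y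
    proof -
      have y: "y \<in> T" "D y \<noteq> 0" using that by (auto simp: T'_def)
      have 1: "comb c' y \<bullet> b0 = 1" using y by (simp add: comb_c' D_def)
      have 2: "comb c' y \<bullet> b = 0" if "b \<in> B" for b using y that by (simp add: comb_c' c0)
      show ?thesis
      proof (cases "b = b0")
        case True
        then have "comb (a' b) y = comb c' y" by (simp add: a'_def comb_def)
        then show ?thesis using True 1 2 that insert.hyps(2) by auto
      next
        case False
        then have "b \<in> B" using that by simp
        show ?thesis
        proof (cases "b' = b0")
          case True
          then show ?thesis using False by (simp add: comb_a' inner_diff_left 1)
        next
          case b': False
          then have "b' \<in> B" using that by simp
          then show ?thesis
            using False dual[OF \<open>b \<in> B\<close> _ y(1), of b'] by (simp add: comb_a' inner_diff_left 2)
        qed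
      qed
    qed
    show ?case
      by (rule exI[of _ T'], rule exI[of _ a']) (intro conjI ballI T'(1-3) F1 F2)
  qed
  from this[OF finite_Basis order_refl] obtain T a where
    T: "open T" "y0 \<in> T" "T \<subseteq> S" "\<forall>b\<in>Basis. \<forall>j\<in>J. smooth_on T (a b j)"
    "\<forall>b\<in>Basis. \<forall>b'\<in>Basis. \<forall>y\<in>T. comb (a b) y \<bullet> b' = (if b = b' then 1 else 0)"
    by (elim exE conjE) (rule that)
  show thesis
  proof (rule that[OF T(1-3), of a])
    show "(\<Sum>j\<in>J. a b j y *\<^sub>R t j y) = b" if "b \<in> Basis" "y \<in> T" for b y
    proof (rule euclidean_eqI)
      fix b' :: 'e assume b': "b' \<in> Basis"
      have "comb (a b) y \<bullet> b' = (if b = b' then 1 else 0)" using T(5) that b' by blast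
      also have "\<dots> = b \<bullet> b'" using that b' by (simp add: inner_Basis)
      finally show "(\<Sum>j\<in>J. a b j y *\<^sub>R t j y) \<bullet> b' = b \<bullet> b'" unfolding comb_def .
    qed
  qed (use T in auto)
qed

section \<open>Charts\<close>

abbreviation chart_image :: "('a, 'e) chart \<Rightarrow> 'e set" where
  "chart_image c \<equiv> snd c ` fst c"

context
  fixes A :: "('a::t2_space, 'e::euclidean_space) chart set"
  assumes atlas: "smooth_atlas A"
begin

lemma chart_homeomorphism:
  "c \<in> A \<Longrightarrow> homeomorphism (fst c) (chart_image c) (snd c) (chart_inv c)"
  using atlas by (auto simp: smooth_atlas_def is_chart_def)

lemma open_chart_domain: "c \<in> A \<Longrightarrow> open (fst c)"
  and open_chart_image: "c \<in> A \<Longrightarrow> open (chart_image c)"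
  using atlas by (auto simp: smooth_atlas_def is_chart_def)

lemma chart_inv_left: "c \<in> A \<Longrightarrow> z \<in> fst c \<Longrightarrow> chart_inv c (snd c z) = z"
  and chart_inv_right: "c \<in> A \<Longrightarrow> y \<in> chart_image c \<Longrightarrow> snd c (chart_inv c y) = y"
  and chart_inv_in: "c \<in> A \<Longrightarrow> y \<in> chart_image c \<Longrightarrow> chart_inv c y \<in> fst c"
  using chart_homeomorphism[of c] by (auto simp: homeomorphism_def)

lemma open_chart_subimage:
  assumes "c \<in> A" "open U"
  shows "open (snd c ` (fst c \<inter> U))"
proof -
  have "snd c ` (fst c \<inter> U) = chart_image c \<inter> chart_inv c -` U"
    using chart_inv_left[OF assms(1)] by (auto simp: image_iff)
  moreover have "continuous_on (chart_image c) (chart_inv c)"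
    using chart_homeomorphism[OF assms(1)] by (simp add: homeomorphism_def)
  ultimately show ?thesis
    using continuous_open_preimage[OF _ open_chart_image[OF assms(1)] assms(2)] by simp
qed

lemma chart_at: "chart_at A x \<in> A" "x \<in> fst (chart_at A x)"
proof -
  have "x \<in> (\<Union>c\<in>A. fst c)" using atlas by (simp add: smooth_atlas_def)
  then have "\<exists>c. c \<in> A \<and> x \<in> fst c" by blast
  from someI_ex[OF this] show "chart_at A x \<in> A" "x \<in> fst (chart_at A x)"
    by (auto simp: chart_at_def)
qed

lemma smooth_transition:
  "c \<in> A \<Longrightarrow> d \<in> A \<Longrightarrow> smooth_on (snd c ` (fst c \<inter> fst d)) (snd d \<circ> chart_inv c)"
  using atlas by (auto simp: smooth_atlas_def compatible_def)

lemma transition_differentiable: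
  "c \<in> A \<Longrightarrow> d \<in> A \<Longrightarrow> z \<in> fst c \<Longrightarrow> z \<in> fst d \<Longrightarrow>
    (snd d \<circ> chart_inv c) differentiable (at (snd c z))"
  by (rule smooth_on_differentiable[OF smooth_transition]) auto

text \<open>
  The chain rule for a change of charts. All transformation rules for tangent vectors are the case
  in which \<open>G\<close> is a coordinate map.
\<close>

lemma chart_change_has_derivative:
  assumes "c \<in> A" "d \<in> A" "z \<in> fst c" "z \<in> fst d"
    and "(G \<circ> chart_inv d) differentiable (at (snd d z))"
  shows "((G \<circ> chart_inv c) has_derivative
      (\<lambda>w. dir_deriv (G \<circ> chart_inv d) (snd d z) (dir_deriv (snd d \<circ> chart_inv c) (snd c z) w)))
      (at (snd c z))"
proof (rule has_derivative_transform_within_open)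
  have "((snd d \<circ> chart_inv c) has_derivative dir_deriv (snd d \<circ> chart_inv c) (snd c z)) (at (snd c z))"
    using transition_differentiable[OF assms(1-4)] by (simp add: frechet_derivative_works)
  moreover have "((G \<circ> chart_inv d) has_derivative dir_deriv (G \<circ> chart_inv d) (snd d z))
      (at ((snd d \<circ> chart_inv c) (snd c z)))"
    using assms(5) chart_inv_left[OF assms(1,3)] by (simp add: frechet_derivative_works)
  ultimately show "((\<lambda>y. (G \<circ> chart_inv d) ((snd d \<circ> chart_inv c) y)) has_derivative
      (\<lambda>w. dir_deriv (G \<circ> chart_inv d) (snd d z) (dir_deriv (snd d \<circ> chart_inv c) (snd c z) w)))
      (at (snd c z))"
    by (rule has_derivative_compose)
  show "open (snd c ` (fst c \<inter> fst d))"
    by (intro open_chart_subimage open_chart_domain assms)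
  show "snd c z \<in> snd c ` (fst c \<inter> fst d)" using assms by blast
  show "(G \<circ> chart_inv d) ((snd d \<circ> chart_inv c) y) = (G \<circ> chart_inv c) y"
    if "y \<in> snd c ` (fst c \<inter> fst d)" for y
    using that chart_inv_left[OF assms(1)] chart_inv_left[OF assms(2)] by auto
qed

lemma chart_change_deriv:
  assumes "c \<in> A" "d \<in> A" "z \<in> fst c" "z \<in> fst d"
    and "(G \<circ> chart_inv d) differentiable (at (snd d z))"
  shows "dir_deriv (G \<circ> chart_inv c) (snd c z) w =
    dir_deriv (G \<circ> chart_inv d) (snd d z) (dir_deriv (snd d \<circ> chart_inv c) (snd c z) w)"
  using frechet_derivative_at[OF chart_change_has_derivative[OF assms]] by metis

lemma to_chart_from_chart:
  assumes "c \<in> A" "d \<in> A" "z \<in> fst c" "z \<in> fst d"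
  shows "to_chart A d z (from_chart A c z w) = dir_deriv (snd d \<circ> chart_inv c) (snd c z) w"
  unfolding to_chart_def from_chart_def
  using assms chart_at[of z]
  by (intro chart_change_deriv[symmetric] transition_differentiable) auto

lemma from_chart_change:
  assumes "c \<in> A" "d \<in> A" "z \<in> fst c" "z \<in> fst d"
  shows "from_chart A d z w = from_chart A c z (dir_deriv (snd c \<circ> chart_inv d) (snd d z) w)"
  unfolding from_chart_def
  using assms chart_at[of z]
  by (intro chart_change_deriv transition_differentiable) auto

lemma linear_from_chart: "c \<in> A \<Longrightarrow> z \<in> fst c \<Longrightarrow> linear (from_chart A c z)"
  unfolding from_chart_def
  using chart_at[of z] by (intro linear_frechet_derivative transition_differentiable) auto

lemma linear_to_chart: "c \<in> A \<Longrightarrow> z \<in> fst c \<Longrightarrow> linear (to_chart A c z)"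
  unfolding to_chart_def
  using chart_at[of z] by (intro linear_frechet_derivative transition_differentiable) auto

text \<open>
  At \<open>x\<close> itself, coordinates in the chosen chart are the tangent vectors, so forms at \<open>x\<close> can be
  read off in this chart without any conversion.
\<close>

lemma from_chart_self: "from_chart A (chart_at A x) x = id"
proof -
  let ?c = "chart_at A x"
  have "((\<lambda>y. y) has_derivative (\<lambda>v. v)) (at (snd ?c x))" by simp
  then have "((snd ?c \<circ> chart_inv ?c) has_derivative (\<lambda>v. v)) (at (snd ?c x))"
    by (rule has_derivative_transform_within_open[OF _ open_chart_image[OF chart_at(1)]])
      (use chart_at(2) chart_inv_right[OF chart_at(1)] in auto)
  from frechet_derivative_at[OF this] show ?thesis by (simp add: from_chart_def id_def)
qed

section \<open>Forms in charts\<close>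

lemma form_in_chart_at:
  "form_in_chart A (chart_at A x) \<omega> (snd (chart_at A x) x) = \<omega> x"
  by (rule ext) (simp add: form_in_chart_def chart_inv_left chart_at from_chart_self)

lemma alternating_form_in_chart:
  assumes "c \<in> A" "y \<in> chart_image c" "alternating k (\<omega> (chart_inv c y))"
  shows "alternating k (form_in_chart A c \<omega> y)"
  unfolding form_in_chart_def[abs_def]
  using assms chart_inv_in by (intro alternating_pullback linear_from_chart) auto

lemma smooth_form_in_chart:
  assumes "differential_form A k \<omega>" "c \<in> A"
  shows "smooth_on (chart_image c) (\<lambda>y. form_in_chart A c \<omega> y vs)"
proof (cases "length vs = k")
  case False
  then have "form_in_chart A c \<omega> y vs = 0" for y
    using assms(1) by (auto simp: differential_form_def form_in_chart_def intro!: alternating_length[of k])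
  then show ?thesis by simp
qed (use assms in \<open>simp add: differential_form_def\<close>)

lemma ext_deriv_eq_ext_terms:
  "ext_deriv A \<omega> x = (\<lambda>vs. ext_terms (form_in_chart A (chart_at A x) \<omega>) (snd (chart_at A x) x) [] vs [])"
  by (rule ext) (simp add: ext_deriv_def ext_terms_def)

lemma alternating_ext_deriv:
  assumes "differential_form A k \<omega>"
  shows "alternating (Suc k) (ext_deriv A \<omega> x)"
  unfolding ext_deriv_eq_ext_terms
proof (rule alternating_ext_terms)
  show "open (chart_image (chart_at A x))" by (intro open_chart_image chart_at)
  show "snd (chart_at A x) x \<in> chart_image (chart_at A x)" using chart_at by blast
  show "alternating k (form_in_chart A (chart_at A x) \<omega> y)" if "y \<in> chart_image (chart_at A x)" for y
    using assms that by (intro alternating_form_in_chart chart_at) (auto simp: differential_form_def)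
  show "(\<lambda>y. form_in_chart A (chart_at A x) \<omega> y vs) differentiable (at (snd (chart_at A x) x))" for vs
    using chart_at by (intro smooth_on_differentiable[OF smooth_form_in_chart[OF assms]]) blast+
qed

section \<open>Multivector fields supported in a chart\<close>

lemma open_complement_of_compact:
  assumes "c \<in> A" "compact K" "K \<subseteq> chart_image c"
  shows "open (- chart_inv c ` K)"
proof -
  have "continuous_on K (chart_inv c)"
    using chart_homeomorphism[OF assms(1)] assms(3)
    by (auto simp: homeomorphism_def intro: continuous_on_subset)
  then have "compact (chart_inv c ` K)" using assms(2) by (intro compact_continuous_image)
  then show ?thesis by (simp add: compact_imp_closed open_Compl)
qed

text \<open>
  By the Hausdorff property the support is closed in the manifold, so a point outside the chart has
  a neighbourhood on which the function is \<open>0\<close>.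
\<close>

lemma smooth_zero_extension:
  assumes cd: "c \<in> A" "d \<in> A" and K: "compact K" "K \<subseteq> chart_image c"
    and sm: "smooth_on (snd d ` (fst d \<inter> fst c)) (\<lambda>y. H (chart_inv d y))"
    and zero: "\<And>z. z \<in> fst d \<Longrightarrow> z \<notin> chart_inv c ` K \<Longrightarrow> H z = 0"
  shows "smooth_on (chart_image d) (\<lambda>y. H (chart_inv d y))"
proof (rule smooth_on_local)
  fix y assume y: "y \<in> chart_image d"
  show "\<exists>T. open T \<and> y \<in> T \<and> smooth_on T (\<lambda>y. H (chart_inv d y))"
  proof (cases "chart_inv d y \<in> fst c")
    case True
    have "y \<in> snd d ` (fst d \<inter> fst c)"
      using True chart_inv_right[OF cd(2) y] chart_inv_in[OF cd(2) y]
      by (intro image_eqI[of _ _ "chart_inv d y"]) auto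
    then show ?thesis using sm open_chart_subimage[OF cd(2) open_chart_domain[OF cd(1)]] by blast
  next
    case False
    note op = open_complement_of_compact[OF cd(1) K]
    define T where "T = snd d ` (fst d \<inter> - chart_inv c ` K)"
    have T: "open T" unfolding T_def by (rule open_chart_subimage[OF cd(2) op])
    have "chart_inv d y \<notin> chart_inv c ` K"
    proof
      assume "chart_inv d y \<in> chart_inv c ` K"
      then obtain k where "k \<in> K" "chart_inv d y = chart_inv c k" by (rule imageE)
      then show False using False K(2) chart_inv_in[OF cd(1), of k] by auto
    qed
    then have "chart_inv d y \<in> fst d \<inter> - chart_inv c ` K"
      using chart_inv_in[OF cd(2) y] by blast
    then have "y \<in> T"
      using imageI[of "chart_inv d y" _ "snd d"] chart_inv_right[OF cd(2) y] unfolding T_def by metis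
    moreover have "smooth_on T (\<lambda>y. H (chart_inv d y))"
    proof (rule smooth_on_cong[OF T smooth_on_const])
      show "0 = H (chart_inv d y)" if "y \<in> T" for y
        using that zero chart_inv_left[OF cd(2)] unfolding T_def by auto
    qed
    ultimately show ?thesis using T by blast
  qed
qed

end

text \<open>
  A combination of products of vector fields that are constant in the coordinates of \<open>c\<close>, extended
  by \<open>0\<close>; the coefficients \<open>a\<close> are functions of the coordinates.
\<close>

definition local_field ::
    "('a, 'e::euclidean_space) chart set \<Rightarrow> ('a, 'e) chart \<Rightarrow> 'i set \<Rightarrow> ('i \<Rightarrow> 'e \<Rightarrow> real) \<Rightarrow>
     ('i \<Rightarrow> 'e list) \<Rightarrow> 'a \<Rightarrow> 'e multivector" where
  "local_field A c I a w z =
     (\<lambda>f. if z \<in> fst c then \<Sum>i\<in>I. a i (snd c z) * wedge (map (from_chart A c z) (w i)) f else 0)"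

lemma multivectors_sum:
  assumes "finite I" "\<And>i. i \<in> I \<Longrightarrow> length (w i) = m"
  shows "(\<lambda>f. \<Sum>i\<in>I. a i * wedge (w i) f) \<in> multivectors m"
proof -
  obtain h where h: "bij_betw h {0..<card I} I" using ex_bij_betw_nat_finite[OF assms(1)] by blast
  have hI: "h n \<in> I" if "n < card I" for n using h that by (auto simp: bij_betw_def)
  have "(\<lambda>f. \<Sum>i\<in>I. a i * wedge (w i) f) = (\<lambda>f. \<Sum>n<card I. a (h n) * wedge (w (h n)) f)"
    by (rule ext, rule sum.reindex_bij_betw[OF h, symmetric, unfolded atLeast0LessThan])
  then show ?thesis
    unfolding multivectors_def using hI assms(2)
    by (auto intro!: exI[of _ "card I"] exI[of _ "\<lambda>n. a (h n)"] exI[of _ "\<lambda>n. w (h n)"])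
qed

lemma contract_local_field:
  assumes "alternating k g" "\<And>i. i \<in> I \<Longrightarrow> length (w i) \<le> k"
  shows "contract (local_field A c I a w z) g us =
    (if z \<in> fst c then \<Sum>i\<in>I. a i (snd c z) * g (map (from_chart A c z) (rev (w i)) @ us) else 0)"
proof -
  have "contract (wedge (map (from_chart A c z) (w i))) g us = g (map (from_chart A c z) (rev (w i)) @ us)"
    if "i \<in> I" for i
    using contract_wedge[OF assms(1), of "map (from_chart A c z) (w i)"] assms(2)[OF that]
    by (simp add: foldr_interior_product rev_map)
  then show ?thesis by (simp add: contract_def local_field_def)
qed

context
  fixes A :: "('a::t2_space, 'e::euclidean_space) chart set"
  assumes atlas: "smooth_atlas A"
begin

text \<open>
  Read in another chart \<open>d\<close>, a coordinate-constant vector becomes its image under the derivative of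
  the coordinate change, which depends smoothly on the point.
\<close>

lemma multivector_field_local_field:
  assumes c: "c \<in> A" and I: "finite I" "\<And>i. i \<in> I \<Longrightarrow> length (w i) = m"
    and a: "\<And>i. i \<in> I \<Longrightarrow> smooth_on (chart_image c) (a i)"
    and K: "compact K" "K \<subseteq> chart_image c" "\<And>i y. i \<in> I \<Longrightarrow> y \<in> chart_image c \<Longrightarrow> y \<notin> K \<Longrightarrow> a i y = 0"
  shows "multivector_field A m (local_field A c I a w)"
  unfolding multivector_field_def
proof (intro conjI allI ballI impI)
  show "local_field A c I a w z \<in> multivectors m" for z
  proof (cases "z \<in> fst c")
    case True
    then show ?thesis
      using multivectors_sum[OF I(1), of "\<lambda>i. map (from_chart A c z) (w i)" m "\<lambda>i. a i (snd c z)"] I(2)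
      by (simp add: local_field_def)
  next
    case False
    then show ?thesis
      using multivectors_sum[of "{}" "\<lambda>i. []" m "\<lambda>i. 0"] by (simp add: local_field_def)
  qed
next
  fix d :: "('a, 'e) chart" and f :: "'e covector" assume d: "d \<in> A" and f: "alternating m f"
  define H where "H z = local_field A c I a w z (\<lambda>vs. f (map (to_chart A d z) vs))" for z
  have "smooth_on (chart_image d) (\<lambda>y. H (chart_inv d y))"
  proof (rule smooth_zero_extension[OF atlas c d K(1,2)])
    fix z assume z: "z \<in> fst d" "z \<notin> chart_inv c ` K"
    show "H z = 0"
    proof (cases "z \<in> fst c")
      case True
      then have "snd c z \<notin> K" using z(2) chart_inv_left[OF atlas c True] by (metis imageI)
      then have "a i (snd c z) = 0" if "i \<in> I" for i using K(3)[OF that] True by blast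
      then show ?thesis by (simp add: H_def local_field_def)
    qed (simp add: H_def local_field_def)
  next
    define T where "T = snd d ` (fst d \<inter> fst c)"
    define T' where "T' = snd c ` (fst c \<inter> fst d)"
    define \<tau> where "\<tau> = snd c \<circ> chart_inv d"
    have op: "open T" "open T'"
      unfolding T_def T'_def by (intro open_chart_subimage[OF atlas] open_chart_domain[OF atlas] c d)+
    have \<tau>: "smooth_on T \<tau>" unfolding T_def \<tau>_def by (rule smooth_transition[OF atlas d c])
    have \<tau>T: "\<tau> ` T \<subseteq> T'"
      unfolding T_def T'_def \<tau>_def using chart_inv_left[OF atlas d] by auto
    have s1: "smooth_on T (\<lambda>y. a i (\<tau> y))" if "i \<in> I" for i
    proof (rule smooth_on_compose[OF op \<tau>T \<tau>])
      show "smooth_on T' (a i)"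
        unfolding T'_def by (rule smooth_on_subset[OF a[OF that]]) blast
    qed
    have s2: "smooth_on T (\<lambda>y. dir_deriv (snd d \<circ> chart_inv c) (\<tau> y) u)" for u
      using smooth_on_compose[OF op \<tau>T \<tau> smooth_on_dir_deriv[OF smooth_transition[OF atlas c d, folded T'_def]]] .
    have s3: "smooth_on T (\<lambda>y. f (map (dir_deriv (snd d \<circ> chart_inv c) (\<tau> y)) us))" for us
      using smooth_on_alternating_eval[OF op(1) f, of "map (\<lambda>u y. dir_deriv (snd d \<circ> chart_inv c) (\<tau> y) u) us"] s2
      by (auto simp: o_def)
    have "smooth_on T (\<lambda>y. \<Sum>i\<in>I. a i (\<tau> y) * f (map (dir_deriv (snd d \<circ> chart_inv c) (\<tau> y)) (w i)))"
      by (intro smooth_on_sum smooth_on_mult op s1 s3)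
    then show "smooth_on (snd d ` (fst d \<inter> fst c)) (\<lambda>y. H (chart_inv d y))"
      unfolding T_def[symmetric]
    proof (rule smooth_on_cong[OF op(1)])
      fix y assume "y \<in> T"
      define z where "z = chart_inv d y"
      have z: "z \<in> fst d" "z \<in> fst c"
        using \<open>y \<in> T\<close> chart_inv_left[OF atlas d] by (auto simp: z_def T_def)
      have \<tau>y: "\<tau> y = snd c z" by (simp add: \<tau>_def z_def)
      have "alternating m (\<lambda>vs. f (map (to_chart A d z) vs))"
        by (intro alternating_pullback f linear_to_chart[OF atlas] d z)
      then have "wedge (map (from_chart A c z) (w i)) (\<lambda>vs. f (map (to_chart A d z) vs))
          = f (map (dir_deriv (snd d \<circ> chart_inv c) (snd c z)) (w i))" if "i \<in> I" for i
        using I(2)[OF that] to_chart_from_chart[OF atlas c d z(2,1)] by (simp add: wedge_def o_def)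
      then show "(\<Sum>i\<in>I. a i (\<tau> y) * f (map (dir_deriv (snd d \<circ> chart_inv c) (\<tau> y)) (w i))) = H (chart_inv d y)"
        using z by (simp add: H_def local_field_def \<tau>y z_def[symmetric])
    qed
  qed
  then show "smooth_on (chart_image d)
      (\<lambda>y. local_field A c I a w (chart_inv d y) (\<lambda>vs. f (map (to_chart A d (chart_inv d y)) vs)))"
    by (simp add: H_def)
qed

text \<open>
  Here \<open>\<eta> = dG\<close>; the exterior derivative in the chosen chart is the antisymmetrised second
  derivative of \<open>G\<close>.
\<close>

lemma closed_form_exact:
  assumes G: "\<And>d. d \<in> A \<Longrightarrow> smooth_on (chart_image d) (G \<circ> chart_inv d)"
    and eta: "\<And>z d v. d \<in> A \<Longrightarrow> z \<in> fst d \<Longrightarrow>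
       \<eta> z [from_chart A d z v] = dir_deriv (G \<circ> chart_inv d) (snd d z) v"
    and len: "\<And>z vs. length vs \<noteq> 1 \<Longrightarrow> \<eta> z vs = 0"
  shows "closed_form A \<eta>"
  unfolding closed_form_def
proof (intro allI)
  fix x vs
  let ?c = "chart_at A x"
  let ?y = "snd ?c x"
  note c = chart_at[OF atlas, of x]
  have op: "open (chart_image ?c)" and y: "?y \<in> chart_image ?c"
    using open_chart_image[OF atlas c(1)] c(2) by auto
  have fc: "form_in_chart A ?c \<eta> y [v] = dir_deriv (G \<circ> chart_inv ?c) y v" if "y \<in> chart_image ?c" for y v
    using eta[OF c(1) chart_inv_in[OF atlas c(1) that], of v] chart_inv_right[OF atlas c(1) that]
    by (simp add: form_in_chart_def)
  have z: "form_in_chart A ?c \<eta> y us = 0" if "length us \<noteq> 1" for y us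
    using that by (simp add: form_in_chart_def len)
  have dd: "dir_deriv (\<lambda>y. form_in_chart A ?c \<eta> y [v]) ?y u = dir_deriv (\<lambda>y. dir_deriv (G \<circ> chart_inv ?c) y v) ?y u" for u v
  proof -
    have "dir_deriv (\<lambda>y. dir_deriv (G \<circ> chart_inv ?c) y v) ?y = dir_deriv (\<lambda>y. form_in_chart A ?c \<eta> y [v]) ?y"
      by (rule frechet_derivative_transform_within_open[OF smooth_on_differentiable[OF smooth_on_dir_deriv[OF G[OF c(1)]] y] op y])
        (simp add: fc)
    then show ?thesis by simp
  qed
  show "ext_deriv A \<eta> x vs = 0"
  proof (cases "length vs = 2")
    case True
    then obtain u v where vs: "vs = [u, v]" by (auto simp: length_Suc_conv numeral_2_eq_2)
    show ?thesis
      using dir_deriv_commute[OF op y G[OF c(1)], of u v]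
      by (simp add: vs ext_deriv_eq_ext_terms[OF atlas] ext_terms_Cons dd)
  next
    case False
    then show ?thesis
      unfolding ext_deriv_def
      by (intro sum.neutral ballI) (simp add: dir_deriv_eq_zero[OF op y] z)
  qed
qed

end

section \<open>Test fields and the invariant form\<close>

lemma cutoff_exists:
  fixes y0 :: "'e::euclidean_space"
  assumes "open S" "y0 \<in> S"
  obtains h :: "'e \<Rightarrow> real" and K where "smooth_on UNIV h" "compact K" "K \<subseteq> S"
    "\<And>y. y \<notin> K \<Longrightarrow> h y = 0" "h y0 > 0"
proof -
  obtain r where "r > 0" "cball y0 r \<subseteq> S" using assms open_contains_cball by blast
  then show thesis
    using smooth_on_bump bump_outside bump_center compact_cball by (intro that[of "bump y0 r" "cball y0 r"])
qed

lemma alternating_zero: "alternating k (\<lambda>_. 0)"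
  by (rule alternating_I) (simp_all add: module_hom_zero)

text \<open>
  Elements of the exterior power see only alternating arguments, hence the hypotheses on both
  \<open>f\<close> and its multiple.
\<close>

lemma contract_scale:
  assumes "\<xi> \<in> multivectors m" "m \<le> k" "alternating k f" "alternating k (\<lambda>vs. c * f vs)"
  shows "contract \<xi> (\<lambda>vs. c * f vs) us = c * contract \<xi> f us"
proof -
  obtain N a w where w: "\<And>i. i < (N::nat) \<Longrightarrow> length (w i) = m"
    and \<xi>: "\<xi> = (\<lambda>f. \<Sum>i<N. a i * wedge (w i) f)"
    using assms(1) unfolding multivectors_def by blast
  have e: "contract \<xi> g us = (\<Sum>i<N. a i * g (rev (w i) @ us))" if "alternating k g" for g
  proof -
    have "contract (wedge (w i)) g us = g (rev (w i) @ us)" if "i < N" for i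
      using contract_wedge[OF \<open>alternating k g\<close>, of "w i"] w[OF that] assms(2)
      by (simp add: foldr_interior_product)
    then show ?thesis by (simp add: contract_def \<xi>)
  qed
  show ?thesis unfolding e[OF assms(3)] e[OF assms(4)] by (simp add: sum_distrib_left mult.left_commute)
qed

text \<open>
  The field \<open>h (\<Omega>(v) u - \<Omega>(u) v)\<close>, with \<open>u\<close> and \<open>v\<close> constant in the coordinates of \<open>c\<close>. The
  lists are reversed to undo the reversal in \<open>contract\<close>.
\<close>

definition kernel_field ::
    "('a, 'e::euclidean_space) chart set \<Rightarrow> ('a, 'e) chart \<Rightarrow> ('a \<Rightarrow> 'e covector) \<Rightarrow> ('e \<Rightarrow> real) \<Rightarrow>
     'e list \<Rightarrow> 'e list \<Rightarrow> 'a \<Rightarrow> 'e multivector" where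
  "kernel_field A c \<Omega> h u v =
     local_field A c UNIV
       (\<lambda>i y. h y * (if i then form_in_chart A c \<Omega> y v else - form_in_chart A c \<Omega> y u))
       (\<lambda>i. rev (if i then u else v))"

context
  fixes A :: "('a::t2_space, 'e::euclidean_space) chart set"
    and k :: nat and \<Omega> \<alpha> :: "'a \<Rightarrow> 'e covector"
  assumes atlas: "smooth_atlas A" and k2: "2 \<le> k"
    and \<Omega>: "differential_form A k \<Omega>" "closed_form A \<Omega>"
    and inj: "\<And>x. inj (\<lambda>v. interior_product v (\<Omega> x))"
    and \<alpha>: "differential_form A k \<alpha>" and inv: "invariant_under_automorphisms A k \<Omega> \<alpha>"
begin

lemma alternating_at: "alternating k (\<Omega> x)" "alternating k (\<alpha> x)"
  using \<Omega> \<alpha> by (auto simp: differential_form_def)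

lemma nondegenerate:
  assumes "\<And>us. \<Omega> x (v # us) = 0"
  shows "v = 0"
proof -
  have "\<Omega> x (0 # us) = 0" for us
  proof (cases "length us + 1 = k")
    case True
    then show ?thesis using linear_0[OF alternating_linear[OF alternating_at(1), of "[]" us]] by simp
  qed (simp add: alternating_length[OF alternating_at(1)])
  then have "interior_product v (\<Omega> x) = interior_product 0 (\<Omega> x)"
    by (simp add: interior_product_def assms)
  then show ?thesis using inj[of x] by (auto dest: injD)
qed

lemma lie_deriv_zero:
  "locally_hamiltonian A \<Omega> m X \<Longrightarrow> m \<le> k \<Longrightarrow> lie_deriv A m X \<alpha> x vs = 0"
  using inv by (auto simp: invariant_under_automorphisms_def)

lemma contract_kernel_field:
  assumes "c \<in> A" "alternating l g" "k \<le> l" "length u = k" "length v = k"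
  shows "contract (kernel_field A c \<Omega> h u v z) g us =
    (if z \<in> fst c then h (snd c z) *
      (\<Omega> z (map (from_chart A c z) v) * g (map (from_chart A c z) u @ us)
       - \<Omega> z (map (from_chart A c z) u) * g (map (from_chart A c z) v @ us)) else 0)"
proof -
  have "contract (kernel_field A c \<Omega> h u v z) g us = 
    (if z \<in> fst c then \<Sum>i\<in>UNIV. (h (snd c z) * (if i then form_in_chart A c \<Omega> (snd c z) v else - form_in_chart A c \<Omega> (snd c z) u)) *
       g (map (from_chart A c z) (rev (rev (if i then u else v))) @ us) else 0)"
    unfolding kernel_field_def using assms by (intro contract_local_field[OF assms(2)]) auto
  then show ?thesis
    using assms by (auto simp: UNIV_bool form_in_chart_def chart_inv_left[OF atlas] algebra_simps)
qed

lemma locally_hamiltonian_kernel_field: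
  assumes c: "c \<in> A" and h: "smooth_on (chart_image c) h" "compact K" "K \<subseteq> chart_image c"
      "\<And>y. y \<notin> K \<Longrightarrow> h y = 0"
    and len: "length u = k" "length v = k"
  shows "locally_hamiltonian A \<Omega> k (kernel_field A c \<Omega> h u v)"
  unfolding locally_hamiltonian_def
proof
  note op = open_chart_image[OF atlas c] and sm = smooth_form_in_chart[OF atlas \<Omega>(1) c]
  have s: "smooth_on (chart_image c) (\<lambda>y. h y * (if i then form_in_chart A c \<Omega> y v else - form_in_chart A c \<Omega> y u))" for i
    using op sm h(1) by (cases i) (simp_all add: smooth_on_mult smooth_on_minus)
  show "multivector_field A k (kernel_field A c \<Omega> h u v)"
    unfolding kernel_field_def
    by (rule multivector_field_local_field[OF atlas c _ _ s h(2,3)]) (auto simp: len h(4))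
  have "contract_field (kernel_field A c \<Omega> h u v) \<Omega> z us = 0" for z us
  proof (cases us)
    case Nil
    then show ?thesis by (simp add: contract_field_def contract_kernel_field[OF c alternating_at(1)] len)
  next
    case (Cons a list)
    then show ?thesis
      by (simp add: contract_field_def contract_kernel_field[OF c alternating_at(1)] len alternating_length[OF alternating_at(1)])
  qed
  then have "contract_field (kernel_field A c \<Omega> h u v) \<Omega> = (\<lambda>z us. 0)" by (intro ext)
  then show "closed_form A (contract_field (kernel_field A c \<Omega> h u v) \<Omega>)"
    by (simp add: closed_form_def ext_deriv_def form_in_chart_def)
qed

text \<open>
  The test function \<open>g\<close> vanishes at \<open>x\<close>, which removes the term with \<open>d\<alpha>\<close> from the Lie derivative
  and reduces \<open>d (i(X)\<alpha>)\<close> to \<open>dg\<close> times the wanted difference.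
\<close>

lemma proportional_pointwise:
  assumes len: "length u = k" "length v = k"
  shows "\<Omega> x v * \<alpha> x u = \<Omega> x u * \<alpha> x v"
proof -
  define c where "c = chart_at A x"
  define y0 where "y0 = snd c x"
  have c: "c \<in> A" "x \<in> fst c" using chart_at[OF atlas] by (auto simp: c_def)
  note V = open_chart_image[OF atlas c(1)]
  have y0: "y0 \<in> chart_image c" using c by (auto simp: y0_def)
  obtain h :: "'e \<Rightarrow> real" and K where h: "smooth_on UNIV h" "compact K" "K \<subseteq> chart_image c"
    "\<And>y. y \<notin> K \<Longrightarrow> h y = 0" "h y0 > 0"
    using cutoff_exists[OF V y0] by metis
  obtain b :: 'e where b: "b \<in> Basis" using nonempty_Basis by blast
  define g where "g y = h y * ((y - y0) \<bullet> b)" for y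
  have "smooth_on UNIV g"
    unfolding g_def
    by (intro smooth_on_mult smooth_on_inner_left smooth_on_diff smooth_on_ident smooth_on_const h(1) open_UNIV)
  then have g: "smooth_on (chart_image c) g" by (rule smooth_on_subset) simp
  define X where "X = kernel_field A c \<Omega> g u v"
  have "locally_hamiltonian A \<Omega> k X"
    unfolding X_def by (rule locally_hamiltonian_kernel_field[OF c(1) g h(2,3) _ len]) (simp add: g_def h(4))
  then have L: "lie_deriv A k X \<alpha> x [b] = 0" by (rule lie_deriv_zero) simp
  have "contract_field X (ext_deriv A \<alpha>) x [b] = 0"
    unfolding contract_field_def X_def
    by (subst contract_kernel_field[OF c(1) alternating_ext_deriv[OF atlas \<alpha>] _ len])
      (simp_all add: g_def y0_def)
  then have E: "ext_deriv A (contract_field X \<alpha>) x [b] = 0" using L by (simp add: lie_deriv_def)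
  define q where "q y = form_in_chart A c \<Omega> y v * form_in_chart A c \<alpha> y u
      - form_in_chart A c \<Omega> y u * form_in_chart A c \<alpha> y v" for y
  have "smooth_on (chart_image c) q"
    unfolding q_def
    by (intro smooth_on_diff smooth_on_mult V smooth_form_in_chart[OF atlas \<Omega>(1) c(1)]
        smooth_form_in_chart[OF atlas \<alpha> c(1)])
  then have q': "(q has_derivative dir_deriv q y0) (at y0)"
    using y0 smooth_on_differentiable by (simp add: frechet_derivative_works[symmetric])
  have h': "(h has_derivative dir_deriv h y0) (at y0)"
    using smooth_on_differentiable[OF h(1)] by (simp add: frechet_derivative_works[symmetric])
  have "((\<lambda>y. g y * q y) has_derivative (\<lambda>w. h y0 * (w \<bullet> b) * q y0)) (at y0)"
    unfolding g_def by (auto intro!: derivative_eq_intros h' q')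
  moreover have "g y * q y = form_in_chart A c (contract_field X \<alpha>) y []" if "y \<in> chart_image c" for y
    using chart_inv_in[OF atlas c(1) that] chart_inv_right[OF atlas c(1) that]
    by (simp add: form_in_chart_def contract_field_def X_def q_def contract_kernel_field[OF c(1) alternating_at(2) _ len])
  ultimately have "((\<lambda>y. form_in_chart A c (contract_field X \<alpha>) y []) has_derivative (\<lambda>w. h y0 * (w \<bullet> b) * q y0)) (at y0)"
    by (rule has_derivative_transform_within_open[OF _ V y0])
  from frechet_derivative_at[OF this]
  have "dir_deriv (\<lambda>y. form_in_chart A c (contract_field X \<alpha>) y []) y0 b = h y0 * q y0"
    using b by (metis inner_same_Basis mult.right_neutral)
  moreover have "ext_deriv A (contract_field X \<alpha>) x [b] =
      dir_deriv (\<lambda>y. form_in_chart A c (contract_field X \<alpha>) y []) y0 b"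
    by (simp add: ext_deriv_eq_ext_terms[OF atlas] ext_terms_Cons c_def y0_def)
  ultimately have "q y0 = 0" using E h(5) by simp
  then show ?thesis
    unfolding q_def y0_def c_def form_in_chart_at[OF atlas] by simp
qed

text \<open>
  A kernel field that does not vanish at \<open>x\<close> now satisfies \<open>i(X)\<alpha> = 0\<close>, so that only the term with
  \<open>d\<alpha>\<close> is left in the Lie derivative. The resulting proportionality is evaluated at \<open>u = t # us\<close>, where
  \<open>d\<alpha>\<close> sees \<open>t\<close> twice.
\<close>

lemma ext_deriv_eq_zero: "ext_deriv A \<alpha> x vs = 0"
proof -
  define c where "c = chart_at A x"
  define \<theta> where "\<theta> = ext_deriv A \<alpha> x"
  have c: "c \<in> A" "x \<in> fst c" using chart_at[OF atlas] by (auto simp: c_def)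
  have T: "from_chart A c x = id" unfolding c_def by (rule from_chart_self[OF atlas])
  have y0: "snd c x \<in> chart_image c" using c by auto
  have \<theta>: "alternating (Suc k) \<theta>" unfolding \<theta>_def by (rule alternating_ext_deriv[OF atlas \<alpha>])
  obtain h :: "'e \<Rightarrow> real" and K where h: "smooth_on UNIV h" "compact K" "K \<subseteq> chart_image c"
    "\<And>y. y \<notin> K \<Longrightarrow> h y = 0" "h (snd c x) > 0"
    using cutoff_exists[OF open_chart_image[OF atlas c(1)] y0] by metis
  have ratio: "\<Omega> x v * \<theta> (u @ [t]) = \<Omega> x u * \<theta> (v @ [t])" if len: "length u = k" "length v = k" for u v t
  proof -
    define X where "X = kernel_field A c \<Omega> h u v"
    have "locally_hamiltonian A \<Omega> k X"
      unfolding X_def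
      by (rule locally_hamiltonian_kernel_field[OF c(1) smooth_on_subset[OF h(1)] h(2,3,4) len]) simp
    then have L: "lie_deriv A k X \<alpha> x [t] = 0" by (rule lie_deriv_zero) simp
    have "contract_field X \<alpha> z us = 0" for z us
    proof (cases us)
      case Nil
      then show ?thesis
        using proportional_pointwise[of "map (from_chart A c z) u" "map (from_chart A c z) v" z]
        by (simp add: contract_field_def X_def contract_kernel_field[OF c(1) alternating_at(2)] len)
    next
      case (Cons a list)
      then show ?thesis
        by (simp add: contract_field_def X_def contract_kernel_field[OF c(1) alternating_at(2)] len alternating_length[OF alternating_at(2)])
    qed
    then have "contract_field X \<alpha> = (\<lambda>z us. 0)" by (intro ext)
    then have "contract_field X (ext_deriv A \<alpha>) x [t] = 0"
      using L by (simp add: lie_deriv_def ext_deriv_def form_in_chart_def)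
    then show ?thesis
      using h(5) c(2) by (simp add: contract_field_def X_def contract_kernel_field[OF c(1) \<theta> _ len] \<theta>_def[symmetric] T)
  qed
  have last: "\<theta> (w @ [t]) = 0" if w: "length w = k" for w t
  proof (rule ccontr)
    assume ne: "\<theta> (w @ [t]) \<noteq> 0"
    have "\<Omega> x (t # us) = 0" for us
    proof (cases "length us + 1 = k")
      case True
      have "\<theta> ((t # us) @ [t]) = 0" using alternating_repeat[OF \<theta>, of "[]" t us "[]"] by simp
      then show ?thesis using ratio[of "t # us" w t] True w ne by simp
    qed (simp add: alternating_length[OF alternating_at(1)])
    then have "t = 0" by (rule nondegenerate)
    then show False
      using ne linear_0[OF alternating_linear[OF \<theta>, of w "[]"]] w by simp
  qed
  show ?thesis
  proof (cases "length vs = Suc k")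
    case True
    then have "vs = butlast vs @ [last vs]" by (cases vs rule: rev_cases) auto
    then show ?thesis using last[of "butlast vs" "last vs"] True by (simp add: \<theta>_def)
  next
    case False
    then show ?thesis using alternating_length[OF \<theta>] by (simp add: \<theta>_def)
  qed
qed

text \<open>
  The contraction of \<open>\<Omega>\<close> with \<open>X\<close> is \<open>dg\<close> for a bump function times the linear function with
  gradient \<open>b\<close>, centred at \<open>x\<close>. The bump is supported where the dual frame of \<open>(k - 1)\<close>-vectors is
  defined; the vectors \<open>t l y\<close> represent the contractions with coordinate-constant \<open>(k - 1)\<close>-vectors.
\<close>

lemma exists_exact_contraction:
  fixes x :: 'a and b :: 'e
  obtains X r where "multivector_field A (k - 1) X" "closed_form A (contract_field X \<Omega>)"
    "r > 0" "\<And>v. contract_field X \<Omega> x [v] = r * (v \<bullet> b)"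
    "\<And>v. (\<lambda>y. form_in_chart A (chart_at A x) (contract_field X \<Omega>) y [v])
        differentiable (at (snd (chart_at A x) x))"
proof -
  define m where "m = k - 1"
  have km: "k = Suc m" using k2 by (simp add: m_def)
  define c where "c = chart_at A x"
  define y0 where "y0 = snd c x"
  define \<Phi> where "\<Phi> = form_in_chart A c \<Omega>"
  have c: "c \<in> A" "x \<in> fst c" using chart_at[OF atlas] by (auto simp: c_def)
  note V = open_chart_image[OF atlas c(1)]
  have y0: "y0 \<in> chart_image c" using c by (auto simp: y0_def)
  have \<Phi>0: "\<Phi> y0 = \<Omega> x" unfolding \<Phi>_def y0_def c_def by (rule form_in_chart_at[OF atlas])
  have \<Phi>s: "smooth_on (chart_image c) (\<lambda>y. \<Phi> y us)" for us
    unfolding \<Phi>_def by (rule smooth_form_in_chart[OF atlas \<Omega>(1) c(1)])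
  have \<Phi>alt: "alternating (Suc m) (\<Phi> y)" if "y \<in> chart_image c" for y
    unfolding \<Phi>_def km[symmetric] by (intro alternating_form_in_chart[OF atlas] c that alternating_at)
  define J where "J = {l :: 'e list. set l \<subseteq> Basis \<and> length l = m}"
  have finJ: "finite J" unfolding J_def by (intro finite_lists_length_eq finite_Basis)
  define t where "t l y = (\<Sum>b\<in>Basis. \<Phi> y (l @ [b]) *\<^sub>R b)" for l y
  have ts: "smooth_on (chart_image c) (t l)" for l
    unfolding t_def by (intro smooth_on_sum smooth_on_scaleR V \<Phi>s smooth_on_const)
  have t_inner: "t l y \<bullet> v = \<Phi> y (l @ [v])" if "l \<in> J" "y \<in> chart_image c" for l y v
    using alternating_expand[OF \<Phi>alt[OF that(2)], of l "[]" v] that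
    by (simp add: t_def J_def inner_sum_left inner_sum_right inner_commute mult.commute)
  have onto: "\<exists>\<xi>. v = (\<Sum>l\<in>J. \<xi> l *\<^sub>R t l y0)" for v
    unfolding J_def t_def \<Phi>0
    by (rule contraction_surjective) (use \<Phi>alt[OF y0] \<Phi>0 nondegenerate in auto)
  obtain T a where T: "open T" "y0 \<in> T" "T \<subseteq> chart_image c"
    and a: "\<And>b j. b \<in> Basis \<Longrightarrow> j \<in> J \<Longrightarrow> smooth_on T (a b j)"
    and dual: "\<And>b y. b \<in> Basis \<Longrightarrow> y \<in> T \<Longrightarrow> (\<Sum>j\<in>J. a b j y *\<^sub>R t j y) = b"
    by (rule smooth_dual_frame[OF V y0 ts onto]) (rule that)
  obtain h :: "'e \<Rightarrow> real" and K where h: "smooth_on UNIV h" "compact K" "K \<subseteq> T"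
    "\<And>y. y \<notin> K \<Longrightarrow> h y = 0" "h y0 > 0"
    using cutoff_exists[OF T(1,2)] by metis
  have KV: "K \<subseteq> chart_image c" using h(3) T(3) by blast
  have opK: "open (- K)" using h(2) by (simp add: compact_imp_closed open_Compl)
  define g where "g y = h y * ((y - y0) \<bullet> b)" for y
  have g: "smooth_on UNIV g"
    unfolding g_def
    by (intro smooth_on_mult smooth_on_inner_left smooth_on_diff smooth_on_ident smooth_on_const h(1) open_UNIV)
  have gd: "g differentiable (at y)" for y using smooth_on_differentiable[OF g] by simp
  have g0: "dir_deriv g y v = 0" if "y \<notin> K" for y v
    using that by (intro dir_deriv_eq_zero[OF opK]) (simp_all add: g_def h(4))
  have gy0: "dir_deriv g y0 v = h y0 * (v \<bullet> b)" for v
  proof -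
    have h': "(h has_derivative dir_deriv h y0) (at y0)"
      using smooth_on_differentiable[OF h(1)] by (simp add: frechet_derivative_works[symmetric])
    have "(g has_derivative (\<lambda>v. h y0 * (v \<bullet> b))) (at y0)"
      unfolding g_def by (auto intro!: derivative_eq_intros h')
    from frechet_derivative_at[OF this] show ?thesis by metis
  qed
  define a' where "a' l y = (if y \<in> T then \<Sum>b\<in>Basis. dir_deriv g y b * a b l y else 0)" for l y
  have a'0: "a' l y = 0" if "y \<notin> K" for l y using that by (simp add: a'_def g0)
  have a's: "smooth_on (chart_image c) (a' l)" if "l \<in> J" for l
  proof (rule smooth_on_local)
    fix y
    show "\<exists>S. open S \<and> y \<in> S \<and> smooth_on S (a' l)"
    proof (cases "y \<in> T")
      case True
      have "smooth_on T (\<lambda>y. \<Sum>b\<in>Basis. dir_deriv g y b * a b l y)"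
        using that by (intro smooth_on_sum smooth_on_mult T a smooth_on_subset[OF smooth_on_dir_deriv[OF g]]) auto
      then have "smooth_on T (a' l)" by (rule smooth_on_cong[OF T(1)]) (simp add: a'_def)
      then show ?thesis using T True by blast
    next
      case False
      have "smooth_on (- K) (a' l)"
        by (rule smooth_on_cong[OF opK smooth_on_const[of _ 0]]) (simp add: a'0)
      then show ?thesis using opK False h(3) by blast
    qed
  qed
  define X where "X = local_field A c J a' rev"
  have lenJ: "length l = m" if "l \<in> J" for l using that by (simp add: J_def)
  have "multivector_field A m X"
    unfolding X_def
    by (rule multivector_field_local_field[OF atlas c(1) finJ _ a's h(2) KV a'0]) (simp_all add: lenJ)
  define \<eta> where "\<eta> = contract_field X \<Omega>"
  have \<eta>: "\<eta> z us = (if z \<in> fst c then \<Sum>l\<in>J. a' l (snd c z) * \<Omega> z (map (from_chart A c z) l @ us) else 0)" for z us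
  proof -
    have "\<eta> z us = (if z \<in> fst c then \<Sum>l\<in>J. a' l (snd c z) * \<Omega> z (map (from_chart A c z) (rev (rev l)) @ us) else 0)"
      unfolding \<eta>_def contract_field_def X_def
      by (rule contract_local_field[OF alternating_at(1)]) (simp add: lenJ km)
    then show ?thesis by simp
  qed
  have \<eta>c: "\<eta> z [from_chart A c z v] = dir_deriv g (snd c z) v" if z: "z \<in> fst c" for z v
  proof -
    let ?y = "snd c z"
    have y: "?y \<in> chart_image c" using z by blast
    have "\<eta> z [from_chart A c z v] = (\<Sum>l\<in>J. a' l ?y * (t l ?y \<bullet> v))"
      using z by (simp add: \<eta> t_inner y \<Phi>_def form_in_chart_def chart_inv_left[OF atlas c(1)])
    also have "\<dots> = (\<Sum>l\<in>J. a' l ?y *\<^sub>R t l ?y) \<bullet> v" by (simp add: inner_sum_left)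
    also have "\<dots> = dir_deriv g ?y v"
    proof (cases "?y \<in> T")
      case True
      have "(\<Sum>l\<in>J. a' l ?y *\<^sub>R t l ?y) = (\<Sum>b\<in>Basis. dir_deriv g ?y b *\<^sub>R (\<Sum>l\<in>J. a b l ?y *\<^sub>R t l ?y))"
        using True by (simp add: a'_def scaleR_sum_left scaleR_sum_right) (rule sum.swap)
      also have "\<dots> = (\<Sum>b\<in>Basis. dir_deriv g ?y b *\<^sub>R b)"
        by (rule sum.cong) (simp_all add: dual True)
      also have "\<dots> \<bullet> v = dir_deriv g ?y v"
        using linear_euclidean_expand[OF linear_frechet_derivative[OF gd, of ?y], of v]
        by (simp add: inner_sum_left inner_sum_right inner_commute mult.commute)
      finally show ?thesis .
    next
      case False
      then have "?y \<notin> K" using h(3) by blast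
      then show ?thesis by (simp add: a'0 g0)
    qed
    finally show ?thesis .
  qed
  \<comment> \<open>the function on the manifold whose differential is the contraction\<close>
  define G where "G z = (if z \<in> fst c then g (snd c z) else 0)" for z
  have Gout: "G z = 0" if "z \<notin> chart_inv c ` K" for z
  proof (cases "z \<in> fst c")
    case True
    then have "snd c z \<notin> K" using that chart_inv_left[OF atlas c(1) True] by (metis imageI)
    then show ?thesis by (simp add: G_def g_def h(4))
  qed (simp add: G_def)
  have Gs: "smooth_on (chart_image d) (G \<circ> chart_inv d)" if d: "d \<in> A" for d
    unfolding o_def
  proof (rule smooth_zero_extension[OF atlas c(1) d h(2) KV _ Gout])
    have op: "open (snd d ` (fst d \<inter> fst c))"
      by (intro open_chart_subimage[OF atlas] open_chart_domain[OF atlas] c d)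
    have "smooth_on (snd d ` (fst d \<inter> fst c)) (\<lambda>y. g ((snd c \<circ> chart_inv d) y))"
      by (rule smooth_on_compose[OF op open_UNIV subset_UNIV smooth_transition[OF atlas d c(1)] g])
    then show "smooth_on (snd d ` (fst d \<inter> fst c)) (\<lambda>y. G (chart_inv d y))"
      by (rule smooth_on_cong[OF op]) (auto simp: G_def chart_inv_left[OF atlas d])
  qed
  have Gc: "dir_deriv (G \<circ> chart_inv c) (snd c z) v = dir_deriv g (snd c z) v" if z: "z \<in> fst c" for z v
  proof -
    have "dir_deriv g (snd c z) = dir_deriv (G \<circ> chart_inv c) (snd c z)"
      by (rule frechet_derivative_transform_within_open[OF gd V])
        (use z in \<open>auto simp: G_def chart_inv_left[OF atlas c(1)]\<close>)
    then show ?thesis by simp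
  qed
  have \<eta>d: "\<eta> z [from_chart A d z v] = dir_deriv (G \<circ> chart_inv d) (snd d z) v"
    if d: "d \<in> A" and zd: "z \<in> fst d" for z d v
  proof (cases "z \<in> fst c")
    case True
    have "(G \<circ> chart_inv c) differentiable (at (snd c z))"
      using True by (intro smooth_on_differentiable[OF Gs[OF c(1)]]) blast
    from chart_change_deriv[OF atlas d c(1) zd True this, of v] show ?thesis
      by (simp add: from_chart_change[OF atlas c(1) d True zd] \<eta>c True Gc)
  next
    case False
    define S where "S = snd d ` (fst d \<inter> - chart_inv c ` K)"
    have S: "open S"
      unfolding S_def by (intro open_chart_subimage[OF atlas d] open_complement_of_compact[OF atlas c(1) h(2) KV])
    have "z \<notin> chart_inv c ` K"
    proof
      assume "z \<in> chart_inv c ` K"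
      then obtain y where "y \<in> K" "z = chart_inv c y" by (rule imageE)
      then show False using False KV chart_inv_in[OF atlas c(1), of y] by auto
    qed
    then have "snd d z \<in> S" unfolding S_def using zd by (intro imageI) simp
    moreover have "(G \<circ> chart_inv d) y = 0" if "y \<in> S" for y
      using that Gout unfolding S_def by (auto simp: chart_inv_left[OF atlas d])
    ultimately have "dir_deriv (G \<circ> chart_inv d) (snd d z) v = 0" by (rule dir_deriv_eq_zero[OF S])
    then show ?thesis using False by (simp add: \<eta>)
  qed
  have \<eta>len: "\<eta> z us = 0" if "length us \<noteq> 1" for z us
    using that by (auto simp: \<eta> lenJ km alternating_length[OF alternating_at(1)] intro!: sum.neutral)
  have closed: "closed_form A \<eta>" by (rule closed_form_exact[OF atlas Gs \<eta>d \<eta>len])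
  show thesis
  proof (rule that[of X "h y0"])
    show "multivector_field A (k - 1) X" using \<open>multivector_field A m X\<close> by (simp add: m_def)
    show "closed_form A (contract_field X \<Omega>)" using closed by (simp add: \<eta>_def)
    show "h y0 > 0" by (rule h(5))
    show "contract_field X \<Omega> x [v] = h y0 * (v \<bullet> b)" for v
      using \<eta>c[OF c(2), of v] gy0[of v] from_chart_self[OF atlas, of x]
      by (simp add: \<eta>_def y0_def c_def)
    show "(\<lambda>y. form_in_chart A (chart_at A x) (contract_field X \<Omega>) y [v]) differentiable (at (snd (chart_at A x) x))" for v
    proof -
      have "smooth_on (chart_image c) (\<lambda>y. form_in_chart A c \<eta> y [v])"
      proof (rule smooth_on_cong[OF V])
        show "smooth_on (chart_image c) (\<lambda>y. dir_deriv g y v)"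
          by (rule smooth_on_subset[OF smooth_on_dir_deriv[OF g]]) simp
        show "dir_deriv g y v = form_in_chart A c \<eta> y [v]" if "y \<in> chart_image c" for y
          using \<eta>c[OF chart_inv_in[OF atlas c(1) that], of v] chart_inv_right[OF atlas c(1) that]
          by (simp add: form_in_chart_def)
      qed
      from smooth_on_differentiable[OF this y0] show ?thesis by (simp add: \<eta>_def c_def y0_def)
    qed
  qed
qed

text \<open>
  On a line every alternating form of degree at least \<open>2\<close> vanishes.
\<close>

lemma dimension_ge_2: "2 \<le> DIM('e)"
proof (rule ccontr)
  assume "\<not> 2 \<le> DIM('e)"
  then have "card (Basis :: 'e set) = 1" using DIM_positive[where 'a='e] by linarith
  then obtain e :: 'e where e: "Basis = {e}" by (rule card_1_singletonE)
  fix x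
  have "\<Omega> x (e # us) = 0" for us
  proof (cases "length us + 1 = k")
    case True
    then obtain w ws where us: "us = w # ws" using k2 by (cases us) auto
    have "\<Omega> x (e # w # ws) = (w \<bullet> e) * \<Omega> x (e # e # ws)"
      using alternating_expand[OF alternating_at(1), where p="[e]" and q=ws and v=w] True by (simp add: e us)
    also have "\<Omega> x (e # e # ws) = 0"
      using alternating_repeat[OF alternating_at(1), where p="[]" and q="[]" and v=e and r=ws] by simp
    finally show ?thesis by (simp add: us)
  qed (simp add: alternating_length[OF alternating_at(1)])
  then have "e = 0" by (rule nondegenerate)
  moreover have "e \<in> Basis" by (simp add: e)
  ultimately show False using nonzero_Basis by blast
qed

lemma nonzero_value: "\<exists>u. length u = k \<and> \<Omega> x u \<noteq> 0"
proof -
  obtain b :: 'e where "b \<in> Basis" using nonempty_Basis by blast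
  then have "b \<noteq> 0" by auto
  then obtain us where "\<Omega> x (b # us) \<noteq> 0" using nondegenerate by blast
  then show ?thesis using alternating_length[OF alternating_at(1)] by blast
qed

text \<open>
  In coordinates the contraction of \<open>\<alpha>\<close> with the field above is \<open>C dg\<close>, and \<open>d (C dg) = dC \<and> dg\<close>
  vanishes at \<open>x\<close>. Taking for \<open>dg\<close> a covector \<open>b = v\<close> orthogonal to \<open>u\<close> and evaluating on \<open>u, v\<close>
  leaves only \<open>dC(u)\<close>. Smoothness of \<open>C\<close> holds because it is a quotient of components near \<open>x\<close>.
\<close>

lemma factor_derivative:
  assumes q: "\<And>z us. \<alpha> z us = q z * \<Omega> z us"
  shows "((q \<circ> chart_inv (chart_at A x)) has_derivative (\<lambda>_. 0)) (at (snd (chart_at A x) x))"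
proof -
  define c where "c = chart_at A x"
  define y0 where "y0 = snd c x"
  have c: "c \<in> A" "x \<in> fst c" using chart_at[OF atlas] by (auto simp: c_def)
  note V = open_chart_image[OF atlas c(1)]
  have y0: "y0 \<in> chart_image c" using c by (auto simp: y0_def)
  define C where "C = q \<circ> chart_inv c"
  obtain u0 where u0: "\<Omega> x u0 \<noteq> 0" using nonzero_value by blast
  note s\<Omega> = smooth_form_in_chart[OF atlas \<Omega>(1) c(1)] and s\<alpha> = smooth_form_in_chart[OF atlas \<alpha> c(1)]
  have f\<Omega>: "form_in_chart A c \<Omega> y0 = \<Omega> x" unfolding y0_def c_def by (rule form_in_chart_at[OF atlas])
  define S where "S = {y \<in> chart_image c. form_in_chart A c \<Omega> y u0 \<noteq> 0}"
  have "S = chart_image c \<inter> (\<lambda>y. form_in_chart A c \<Omega> y u0) -` (- {0})" by (auto simp: S_def)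
  then have S: "open S"
    using continuous_open_preimage[OF smooth_on_continuous[OF s\<Omega>] V, of "- {0}"] by (simp add: open_Compl)
  have yS: "y0 \<in> S" using y0 u0 f\<Omega> by (simp add: S_def)
  have "smooth_on S (\<lambda>y. form_in_chart A c \<alpha> y u0 * inverse (form_in_chart A c \<Omega> y u0))"
    by (intro smooth_on_mult smooth_on_inverse S smooth_on_subset[OF s\<Omega>] smooth_on_subset[OF s\<alpha>])
      (auto simp: S_def)
  then have "smooth_on S C"
    by (rule smooth_on_cong[OF S]) (auto simp: S_def C_def form_in_chart_def q)
  then have C': "(C has_derivative dir_deriv C y0) (at y0)"
    using smooth_on_differentiable[OF _ yS] by (simp add: frechet_derivative_works[symmetric])
  have key: "dir_deriv C y0 u * (v \<bullet> b) = dir_deriv C y0 v * (u \<bullet> b)" for u v b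
  proof -
    obtain X r where X: "multivector_field A (k - 1) X" "closed_form A (contract_field X \<Omega>)"
      and r: "r > 0" "\<And>v. contract_field X \<Omega> x [v] = r * (v \<bullet> b)"
      and d: "\<And>v. (\<lambda>y. form_in_chart A (chart_at A x) (contract_field X \<Omega>) y [v])
        differentiable (at (snd (chart_at A x) x))"
      by (rule exists_exact_contraction[where b=b and x=x]) (rule that)
    define \<eta> where "\<eta> y v = form_in_chart A c (contract_field X \<Omega>) y [v]" for y v
    have \<eta>': "((\<lambda>y. \<eta> y v) has_derivative dir_deriv (\<lambda>y. \<eta> y v) y0) (at y0)" for v
      using d by (simp add: \<eta>_def frechet_derivative_works[symmetric] c_def y0_def)
    have \<eta>0: "\<eta> y0 v = r * (v \<bullet> b)" for v
      unfolding \<eta>_def y0_def c_def form_in_chart_at[OF atlas] by (rule r)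
    have Xm: "X z \<in> multivectors (k - 1)" for z using X(1) by (simp add: multivector_field_def)
    have cs: "contract_field X \<alpha> z us = q z * contract_field X \<Omega> z us" for z us
    proof -
      have "\<alpha> z = (\<lambda>vs. q z * \<Omega> z vs)" using q by blast
      then show ?thesis
        unfolding contract_field_def using contract_scale[OF Xm[of z] _ alternating_at(1)[of z], where c="q z" and us=us] alternating_at(2)[of z] by simp
    qed
    have fa: "form_in_chart A c (contract_field X \<alpha>) y [v] = C y * \<eta> y v" for y v
      by (simp add: form_in_chart_def cs \<eta>_def C_def)
    have "lie_deriv A (k - 1) X \<alpha> x [u, v] = 0"
      by (rule lie_deriv_zero[OF _ diff_le_self]) (unfold locally_hamiltonian_def, intro conjI X)
    moreover have "contract_field X (ext_deriv A \<alpha>) x [u, v] = 0"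
    proof -
      have "ext_deriv A \<alpha> x = (\<lambda>vs. 0)" by (rule ext) (rule ext_deriv_eq_zero)
      then show ?thesis
        unfolding contract_field_def
        using contract_scale[OF Xm[of x] _ alternating_zero, where k=k and c=0 and us="[u, v]"]
        by (simp add: alternating_zero)
    qed
    ultimately have "ext_deriv A (contract_field X \<alpha>) x [u, v] = 0" by (simp add: lie_deriv_def)
    then have 1: "dir_deriv (\<lambda>y. C y * \<eta> y v) y0 u = dir_deriv (\<lambda>y. C y * \<eta> y u) y0 v"
      by (simp add: ext_deriv_eq_ext_terms[OF atlas] ext_terms_Cons c_def[symmetric] y0_def[symmetric] fa)
    have "ext_deriv A (contract_field X \<Omega>) x [u, v] = 0"
      using X(2) by (simp add: closed_form_def)
    then have 2: "dir_deriv (\<lambda>y. \<eta> y v) y0 u = dir_deriv (\<lambda>y. \<eta> y u) y0 v"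
      by (simp add: ext_deriv_eq_ext_terms[OF atlas] ext_terms_Cons c_def[symmetric] y0_def[symmetric] \<eta>_def)
    have 3: "dir_deriv (\<lambda>y. C y * \<eta> y v) y0 u = C y0 * dir_deriv (\<lambda>y. \<eta> y v) y0 u + dir_deriv C y0 u * \<eta> y0 v" for u v
      using frechet_derivative_at[OF has_derivative_mult[OF C' \<eta>'[of v]]] by metis
    have "dir_deriv C y0 u * \<eta> y0 v = dir_deriv C y0 v * \<eta> y0 u"
      using 1 2 unfolding 3 by simp
    then show ?thesis using r(1) by (simp add: \<eta>0)
  qed
  have "dir_deriv C y0 u = 0" for u
  proof -
    obtain v where v: "v \<noteq> 0" "orthogonal u v" using orthogonal_to_vector_exists[OF dimension_ge_2] .
    then show ?thesis using key[of u v v] by (simp add: orthogonal_def)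
  qed
  then have "dir_deriv C y0 = (\<lambda>_. 0)" by blast
  then show ?thesis using C' by (simp add: C_def c_def y0_def)
qed

text \<open>
  The derivative of \<open>q\<close> is known at each point only in the chart chosen there; the chart change
  formula carries it to one fixed chart, where \<open>q\<close> is then constant on a ball.
\<close>

lemma factor_locally_constant:
  assumes q: "\<And>z us. \<alpha> z us = q z * \<Omega> z us"
  shows "\<exists>T. open T \<and> x \<in> T \<and> (\<forall>z\<in>T. q z = q x)"
proof -
  define c where "c = chart_at A x"
  have c: "c \<in> A" "x \<in> fst c" using chart_at[OF atlas] by (auto simp: c_def)
  note V = open_chart_image[OF atlas c(1)]
  have "snd c x \<in> chart_image c" using c by auto
  then obtain e where e: "e > 0" "ball (snd c x) e \<subseteq> chart_image c" using V openE by blast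
  have d: "((q \<circ> chart_inv c) has_derivative (\<lambda>_. 0)) (at y)" if "y \<in> chart_image c" for y
  proof -
    define z where "z = chart_inv c y"
    have z: "z \<in> fst c" "snd c z = y"
      using chart_inv_in[OF atlas c(1) that] chart_inv_right[OF atlas c(1) that] by (auto simp: z_def)
    note D = factor_derivative[OF q, of z] and cz = chart_at[OF atlas, of z]
    have "(q \<circ> chart_inv (chart_at A z)) differentiable (at (snd (chart_at A z) z))"
      using D by (auto simp: differentiable_def)
    from chart_change_has_derivative[OF atlas c(1) cz(1) z(1) cz(2) this]
    show ?thesis using frechet_derivative_at[OF D] z(2) by (metis (no_types, lifting) ext)
  qed
  define T where "T = fst c \<inter> snd c -` ball (snd c x) e"
  have "continuous_on (fst c) (snd c)" using chart_homeomorphism[OF atlas c(1)] by (simp add: homeomorphism_def)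
  then have "open T"
    unfolding T_def by (rule continuous_open_preimage) (simp_all add: open_chart_domain[OF atlas c(1)])
  moreover have "x \<in> T" using c e by (simp add: T_def)
  moreover have "q z = q x" if "z \<in> T" for z
  proof -
    have "(q \<circ> chart_inv c) (snd c z) = (q \<circ> chart_inv c) (snd c x)"
    proof (rule has_derivative_zero_unique[OF convex_ball[of "snd c x" e]])
      show "((q \<circ> chart_inv c) has_derivative (\<lambda>_. 0)) (at y within ball (snd c x) e)"
        if "y \<in> ball (snd c x) e" for y
        by (rule has_derivative_at_withinI[OF d[OF subsetD[OF e(2) that]]])
    qed (use that e(1) in \<open>simp_all add: T_def\<close>)
    then show ?thesis using that c by (simp add: T_def chart_inv_left[OF atlas c(1)])
  qed
  ultimately show ?thesis by blast
qed

lemma constant_multiple: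
  assumes "connected (UNIV :: 'a set)"
  shows "\<exists>r. \<forall>x vs. \<alpha> x vs = r * \<Omega> x vs"
proof -
  have "\<exists>r. \<forall>vs. \<alpha> x vs = r * \<Omega> x vs" for x
  proof -
    obtain u where u: "length u = k" "\<Omega> x u \<noteq> 0" using nonzero_value by blast
    have "\<alpha> x vs = (\<alpha> x u / \<Omega> x u) * \<Omega> x vs" for vs
    proof (cases "length vs = k")
      case True
      then show ?thesis using proportional_pointwise[OF True u(1), of x] u(2) by (simp add: field_simps)
    qed (simp add: alternating_length[OF alternating_at(1)] alternating_length[OF alternating_at(2)])
    then show ?thesis by blast
  qed
  then obtain q where q: "\<And>x vs. \<alpha> x vs = q x * \<Omega> x vs" by metis
  have "q constant_on UNIV"
    using factor_locally_constant[OF q] by (intro locally_constant_imp_constant[OF assms]) simp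
  then obtain r where "\<And>x. q x = r" by (auto simp: constant_on_def)
  then show ?thesis using q by auto
qed

end

theorem theorem1p2:
  fixes A :: "('a::t2_space, 'e::euclidean_space) chart set"
    and k :: nat
    and \<Omega> \<alpha> :: "'a \<Rightarrow> 'e covector"
  assumes "locally_homogeneous_multisymplectic A k \<Omega>"
    and "differential_form A k \<alpha>"
    and "invariant_under_automorphisms A k \<Omega> \<alpha>"
  shows "\<exists>c::real. \<forall>x vs. \<alpha> x vs = c * \<Omega> x vs"
proof -
  have ms: "multisymplectic A k \<Omega>"
    using assms(1) by (simp add: locally_homogeneous_multisymplectic_def)
  then have "smooth_atlas A" "connected (UNIV :: 'a set)"
    by (auto simp: multisymplectic_def smooth_manifold_def)
  with ms assms(2,3) show ?thesis
    unfolding multisymplectic_def by (intro constant_multiple[of A k \<Omega> \<alpha>]) auto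
qed

end
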